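(* Write "$X \geq Y$" (for two circuit distances $X,Y$) to mean that for every polyhedron $P$ of the form below and every pair of vertices $v^{(1)},v^{(2)}$ of $P$ one has $X(v^{(1)},v^{(2)})\geq Y(v^{(1)},v^{(2)})$, and "$X>Y$" to mean that $X\geq Y$ holds and, in addition, there exist such a polyhedron and a pair of its vertices for which $X(v^{(1)},v^{(2)})>Y(v^{(1)},v^{(2)})$. Then the circuit distances satisfy the following hierarchy: (i) $\mathcal{CD}_{efmb}>\mathcal{CD}_{efm}$ and $\mathcal{CD}_{efmr}>\mathcal{CD}_{efm}$; (ii) $\mathcal{CD}_{efmb}>\mathcal{CD}_{fmb}$, $\mathcal{CD}_{efm}>\mathcal{CD}_{fm}$, $\mathcal{CD}_{efmr}>\mathcal{CD}_{fmr}$; (iii) $\mathcal{CD}_{fmb}>\mathcal{CD}_{fm}$ and $\mathcal{CD}_{fmr}>\mathcal{CD}_{fm}$; (iv) $\mathcal{CD}_{fmb}>\mathcal{CD}_{fb}$, $\mathcal{CD}_{fm}>\mathcal{CD}_{f}$, $\mathcal{CD}_{fmr}>\mathcal{CD}_{fr}$; (v) $\mathcal{CD}_{fb}\geq\mathcal{CD}_{f}$ and $\mathcal{CD}_{fr}>\mathcal{CD}_{f}$; (vi) $\mathcal{CD}_{fbr}>\mathcal{CD}_{fb}$ and $\mathcal{CD}_{fbr}\geq\mathcal{CD}_{fr}$; (vii) $\mathcal{CD}_{fs}>\mathcal{CD}_{fbr}$; (viii) $\mathcal{CD}_{f}>\mathcal{CD}$.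
   Context: Polyhedra are of the form $P=\{z\in\mathbb{R}^n: Az=b,\ Bz\leq d\}$ with $A\in\mathbb{Z}^{m_A\times n}$, $B\in\mathbb{Z}^{m_B\times n}$ (if no matrix $A$ is present, $\ker A=\mathbb{R}^n$ and $\operatorname{rank}A=0$). A circuit of $(A,B)$ is a vector $g\in\ker(A)\setminus\{0\}$ such that $Bg$ has inclusion-minimal support in $\{Bz: z\in\ker(A)\setminus\{0\}\}$, normalized to have coprime integer components. For vertices $v^{(1)},v^{(2)}$ of $P$, a circuit walk of length $k$ from $v^{(1)}$ to $v^{(2)}$ is a sequence $v^{(1)}=y^{(0)},y^{(1)},\dots,y^{(k)}=v^{(2)}$ with $y^{(i+1)}-y^{(i)}=\alpha_i g^i$ for circuits $g^i$ and reals $\alpha_i>0$. Possible properties of a walk: (e) edge walk: $y^{(i)},y^{(i+1)}$ are adjacent vertices of $P$ for all $i$; (f) feasible: $y^{(i)}\in P$ for all $i$; (m) maximal: for all $i$, $y^{(i)}+\alpha g^i\notin P$ for every $\alpha>\alpha_i$; (r) non-repetitive: $g^i\neq g^j$ for $i\neq j$; (b) non-backwards: $g^j\neq -g^i$ for all $i,j$; (s) sign-compatible: $(Bg^i)_l(Bg^j)_l\geq0$ and $(Bg^i)_l\,(B(v^{(2)}-v^{(1)}))_l\geq 0$ for all $i,j$ and all $l=1,\dots,m_B$. For a set $X$ of these letters, $\mathcal{CD}_X(v^{(1)},v^{(2)})$ denotes the minimum length of a finite circuit walk from $v^{(1)}$ to $v^{(2)}$ having all properties in $X$; $\mathcal{CD}$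 without subscript imposes no restriction. *)

theory Defs
  imports "Jordan_Normal_Form.Matrix_Kernel" "HOL-Library.Extended_Nat"
begin

text \<open>
  Dimensions are quantified inside the statement, so vectors and matrices are those of
  Jordan_Normal_Form, whose dimensions are terms. A matrix with zero rows encodes the case that
  no equality constraints are present: its kernel is then the whole space.
\<close>

abbreviation rmat :: "int mat \<Rightarrow> real mat" where "rmat \<equiv> map_mat real_of_int"
abbreviation rvec :: "int vec \<Rightarrow> real vec" where "rvec \<equiv> map_vec real_of_int"

definition polyhedron_data ::
    "nat \<Rightarrow> int mat \<Rightarrow> int mat \<Rightarrow> real vec \<Rightarrow> real vec \<Rightarrow> bool" where
  "polyhedron_data n A B b d \<longleftrightarrow>
     A \<in> carrier_mat (dim_vec b) n \<and> B \<in> carrier_mat (dim_vec d) n"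

definition polyhedron_of :: "int mat \<Rightarrow> int mat \<Rightarrow> real vec \<Rightarrow> real vec \<Rightarrow> real vec set" where
  "polyhedron_of A B b d =
     {z \<in> carrier_vec (dim_col A). rmat A *\<^sub>v z = b \<and> rmat B *\<^sub>v z \<le> d}"

text \<open>
  The next definitions transfer the notions of segment, extreme point, face and edge from
  HOL-Analysis, which are tied to type classes that vectors of term dimension do not instantiate.
\<close>

definition closed_seg :: "real vec \<Rightarrow> real vec \<Rightarrow> real vec set" where
  "closed_seg x y = {(1 - t) \<cdot>\<^sub>v x + t \<cdot>\<^sub>v y | t. 0 \<le> t \<and> t \<le> 1}"

definition open_seg :: "real vec \<Rightarrow> real vec \<Rightarrow> real vec set" where
  "open_seg x y = closed_seg x y - {x, y}"

definition convex_vecs :: "real vec set \<Rightarrow> bool" where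
  "convex_vecs S \<longleftrightarrow> (\<forall>x\<in>S. \<forall>y\<in>S. closed_seg x y \<subseteq> S)"

definition vertex_of :: "real vec \<Rightarrow> real vec set \<Rightarrow> bool" where
  "vertex_of v P \<longleftrightarrow> v \<in> P \<and> (\<forall>x\<in>P. \<forall>y\<in>P. v \<notin> open_seg x y)"

definition vec_face_of :: "real vec set \<Rightarrow> real vec set \<Rightarrow> bool" where
  "vec_face_of F P \<longleftrightarrow>
     F \<subseteq> P \<and> convex_vecs F \<and>
     (\<forall>x\<in>P. \<forall>y\<in>P. \<forall>z\<in>F. z \<in> open_seg x y \<longrightarrow> x \<in> F \<and> y \<in> F)"

definition adjacent_vertices :: "real vec set \<Rightarrow> real vec \<Rightarrow> real vec \<Rightarrow> bool" where
  "adjacent_vertices P v w \<longleftrightarrow>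
     vertex_of v P \<and> vertex_of w P \<and> v \<noteq> w \<and> vec_face_of (closed_seg v w) P"

definition supp :: "real vec \<Rightarrow> nat set" where
  "supp v = {i. i < dim_vec v \<and> v $ i \<noteq> 0}"

definition circuit :: "int mat \<Rightarrow> int mat \<Rightarrow> int vec \<Rightarrow> bool" where
  "circuit A B g \<longleftrightarrow>
     rvec g \<in> mat_kernel (rmat A) - {0\<^sub>v (dim_col A)} \<and>
     \<not> (\<exists>z \<in> mat_kernel (rmat A) - {0\<^sub>v (dim_col A)}.
          supp (rmat B *\<^sub>v z) \<subset> supp (rmat B *\<^sub>v rvec g)) \<and>
     Gcd (set\<^sub>v g) = 1"

text \<open>
  A walk of length \<open>k\<close> is given by its points \<open>y 0, \<dots>, y k\<close>, its circuits
  \<open>g 0, \<dots>, g (k - 1)\<close> and its step lengths \<open>\<alpha> 0, \<dots>, \<alpha> (k - 1)\<close>; values at other indices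
  are irrelevant. The points need not lie in the polyhedron.
\<close>

definition circuit_walk ::
    "int mat \<Rightarrow> int mat \<Rightarrow> real vec \<Rightarrow> real vec \<Rightarrow> nat \<Rightarrow>
     (nat \<Rightarrow> real vec) \<Rightarrow> (nat \<Rightarrow> int vec) \<Rightarrow> (nat \<Rightarrow> real) \<Rightarrow> bool" where
  "circuit_walk A B v1 v2 k y g \<alpha> \<longleftrightarrow>
     y 0 = v1 \<and> y k = v2 \<and> (\<forall>i\<le>k. y i \<in> carrier_vec (dim_col A)) \<and>
     (\<forall>i<k. circuit A B (g i) \<and> \<alpha> i > 0 \<and> y (Suc i) - y i = \<alpha> i \<cdot>\<^sub>v rvec (g i))"

datatype walk_property =
  Edge | Feasible | Maximal | NonRepetitive | NonBackwards | SignCompatible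

fun has_property ::
    "walk_property \<Rightarrow> int mat \<Rightarrow> int mat \<Rightarrow> real vec \<Rightarrow> real vec \<Rightarrow> real vec \<Rightarrow> real vec \<Rightarrow> nat \<Rightarrow>
     (nat \<Rightarrow> real vec) \<Rightarrow> (nat \<Rightarrow> int vec) \<Rightarrow> (nat \<Rightarrow> real) \<Rightarrow> bool" where
  "has_property Edge A B b d v1 v2 k y g \<alpha> \<longleftrightarrow>
     (\<forall>i<k. adjacent_vertices (polyhedron_of A B b d) (y i) (y (Suc i)))"
| "has_property Feasible A B b d v1 v2 k y g \<alpha> \<longleftrightarrow>
     (\<forall>i\<le>k. y i \<in> polyhedron_of A B b d)"
| "has_property Maximal A B b d v1 v2 k y g \<alpha> \<longleftrightarrow>
     (\<forall>i<k. \<forall>\<beta>>\<alpha> i. y i + \<beta> \<cdot>\<^sub>v rvec (g i) \<notin> polyhedron_of A B b d)"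
| "has_property NonRepetitive A B b d v1 v2 k y g \<alpha> \<longleftrightarrow>
     (\<forall>i<k. \<forall>j<k. i \<noteq> j \<longrightarrow> g i \<noteq> g j)"
| "has_property NonBackwards A B b d v1 v2 k y g \<alpha> \<longleftrightarrow>
     (\<forall>i<k. \<forall>j<k. g j \<noteq> - g i)"
| "has_property SignCompatible A B b d v1 v2 k y g \<alpha> \<longleftrightarrow>
     (\<forall>l<dim_row B.
        (\<forall>i<k. \<forall>j<k. (rmat B *\<^sub>v rvec (g i)) $ l * (rmat B *\<^sub>v rvec (g j)) $ l \<ge> 0) \<and>
        (\<forall>i<k. (rmat B *\<^sub>v rvec (g i)) $ l * (rmat B *\<^sub>v (v2 - v1)) $ l \<ge> 0))"

type_synonym circuit_distance =
  "int mat \<Rightarrow> int mat \<Rightarrow> real vec \<Rightarrow> real vec \<Rightarrow> real vec \<Rightarrow> real vec \<Rightarrow> enat"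

text \<open>
  The minimum is taken in the extended naturals: if no walk with the required properties exists,
  the distance is infinite.
\<close>

definition CD :: "walk_property set \<Rightarrow> circuit_distance" where
  "CD X A B b d v1 v2 =
     (INF k \<in> {k. \<exists>y g \<alpha>. circuit_walk A B v1 v2 k y g \<alpha> \<and>
                    (\<forall>p\<in>X. has_property p A B b d v1 v2 k y g \<alpha>)}. enat k)"

definition cd_ge :: "circuit_distance \<Rightarrow> circuit_distance \<Rightarrow> bool"
    (infix \<open>\<ge>\<^sub>C\<^sub>D\<close> 50) where
  "X \<ge>\<^sub>C\<^sub>D Y \<longleftrightarrow>
     (\<forall>n A B b d v1 v2. polyhedron_data n A B b d \<longrightarrow>
        vertex_of v1 (polyhedron_of A B b d) \<longrightarrow> vertex_of v2 (polyhedron_of A B b d) \<longrightarrow>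
        X A B b d v1 v2 \<ge> Y A B b d v1 v2)"

definition cd_gt :: "circuit_distance \<Rightarrow> circuit_distance \<Rightarrow> bool"
    (infix \<open>>\<^sub>C\<^sub>D\<close> 50) where
  "X >\<^sub>C\<^sub>D Y \<longleftrightarrow>
     X \<ge>\<^sub>C\<^sub>D Y \<and>
     (\<exists>n A B b d v1 v2. polyhedron_data n A B b d \<and>
        vertex_of v1 (polyhedron_of A B b d) \<and> vertex_of v2 (polyhedron_of A B b d) \<and>
        X A B b d v1 v2 > Y A B b d v1 v2)"

end

theory Submission
  imports Defs
begin

text \<open>
  Adding properties to a walk can only increase the distance, so most weak inequalities are
  immediate. The exception is that a feasible sign-compatible walk can be made non-repetitive: in
  every row it moves monotonically, so repeated circuits can be merged into one step without
  leaving the polyhedron.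

  All but one of the strict inequalities come from a single constraint matrix. Four copies of a
  polygon in the \<open>(p, q)\<close>-plane are coupled by requiring \<open>p - q = t\<close> for one common, bounded \<open>t\<close>.
  A circuit either moves a single copy diagonally, or changes \<open>t\<close> and moves every copy parallel to
  one of the axes. Four copies cannot be served by three single-copy steps, hence walks of at most
  three steps must change \<open>t\<close>; the bounds on \<open>t\<close> then force such a walk to repeat a circuit, or
  to take a step and later undo a part of it.

  The remaining inequality concerns non-repetitive edge walks. It is witnessed by an unbounded
  polyhedron in three dimensions whose graph consists of two pentagons with a common vertex; the
  first and the last edge of the only shortest walk between certain vertices of the two pentagons
  are parallel.
\<close>

subsection \<open>Comparing circuit distances\<close>

text \<open>In the \<open>(p, q)\<close>-plane, \<open>pt t q\<close> places all four copies at
  \<open>(q + t, q)\<close>. With \<open>- 1 \<le> t \<le> 1\<close>, a copy that gets from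
  \<open>(0, 0)\<close> to \<open>(2, 2)\<close> by three axis-parallel moves must begin and end
  with the same move, because \<open>t\<close> returns to 0 and may never leave this range. With
  \<open>- 1 \<le> t \<le> 2\<close>, the short route from \<open>(0, 0)\<close> to
  \<open>(1, 2)\<close> turns at \<open>(1, 0)\<close>, but a maximal step runs on to
  \<open>(2, 0)\<close> and the excess has to be undone by the opposite circuit. Sign-compatibility
  forbids raising \<open>t\<close> on this route at all. Edge walks lose because the vertical step
  from \<open>(1, 0)\<close> to \<open>(1, 2)\<close> crosses the interior of the hexagon.

  In the three-dimensional example the rotation \<open>(x, y, z) \<mapsto> (- x, - y, z)\<close>
  carries the short walk to its reverse. An edge parallel to the \<open>x\<close>-axis is flipped
  once by the rotation and once by the reversal, so the first and the last circuit are equal rather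
  than opposite.

  A circuit and its negative are sign-compatible only if \<open>B\<close> maps the circuit to 0, and
  then the polyhedron contains a line; this is where the vertex assumption enters.\<close>

lemma CD_le:
  assumes "circuit_walk A B v1 v2 k y g \<alpha>"
    and "\<And>p. p \<in> X \<Longrightarrow> has_property p A B b d v1 v2 k y g \<alpha>"
  shows "CD X A B b d v1 v2 \<le> enat k"
  unfolding CD_def by (rule INF_lower) (use assms in blast)

lemma le_CD:
  assumes "\<And>k y g \<alpha>. circuit_walk A B v1 v2 k y g \<alpha> \<Longrightarrow>
    (\<And>p. p \<in> X \<Longrightarrow> has_property p A B b d v1 v2 k y g \<alpha>) \<Longrightarrow> l \<le> k"
  shows "enat l \<le> CD X A B b d v1 v2"
  unfolding CD_def by (rule INF_greatest) (use assms in auto)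

lemma CD_mono: "Y \<subseteq> X \<Longrightarrow> CD Y A B b d v1 v2 \<le> CD X A B b d v1 v2"
  unfolding CD_def by (rule INF_superset_mono) blast+

lemma cd_ge_superset: "Y \<subseteq> X \<Longrightarrow> CD X \<ge>\<^sub>C\<^sub>D CD Y"
  unfolding cd_ge_def using CD_mono by blast

lemma cd_gtI:
  assumes "CD X \<ge>\<^sub>C\<^sub>D CD Y" and "polyhedron_data n A B b d"
    and "vertex_of v1 (polyhedron_of A B b d)" and "vertex_of v2 (polyhedron_of A B b d)"
    and "CD Y A B b d v1 v2 \<le> enat k" and "enat l \<le> CD X A B b d v1 v2" and "k < l"
  shows "CD X >\<^sub>C\<^sub>D CD Y"
proof -
  have "CD Y A B b d v1 v2 < CD X A B b d v1 v2"
    using assms(5-7) by (meson enat_ord_simps(2) le_less_trans less_le_trans)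
  then show ?thesis unfolding cd_gt_def using assms(1-4) by blast
qed

subsection \<open>Faces cut out by affine functions\<close>

definition affine_fun :: "nat \<Rightarrow> (real vec \<Rightarrow> real) \<Rightarrow> bool" where
  "affine_fun n f \<longleftrightarrow> (\<forall>x\<in>carrier_vec n. \<forall>y\<in>carrier_vec n. \<forall>s.
     f ((1 - s) \<cdot>\<^sub>v x + s \<cdot>\<^sub>v y) = (1 - s) * f x + s * f y)"

lemma open_segE:
  assumes "z \<in> open_seg x y" and "x \<in> carrier_vec n" and "y \<in> carrier_vec n"
  obtains s where "0 < s" "s < 1" "z = (1 - s) \<cdot>\<^sub>v x + s \<cdot>\<^sub>v y" "z \<noteq> x" "z \<noteq> y"
proof -
  obtain s where s: "0 \<le> s" "s \<le> 1" "z = (1 - s) \<cdot>\<^sub>v x + s \<cdot>\<^sub>v y" "z \<noteq> x" "z \<noteq> y"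
    using assms(1) unfolding open_seg_def closed_seg_def by auto
  have "s \<noteq> 0"
  proof
    assume "s = 0"
    then have "z = x" using s(3) assms(2,3) by (intro eq_vecI) auto
    then show False using s(4) by simp
  qed
  moreover have "s \<noteq> 1"
  proof
    assume "s = 1"
    then have "z = y" using s(3) assms(2,3) by (intro eq_vecI) auto
    then show False using s(5) by simp
  qed
  ultimately show ?thesis using that[of s] s by auto
qed

text \<open>Strictly inside a segment an affine function is a mean of the end values with positive
  weights, so a unique maximiser never lies there.\<close>

lemma vertex_ofI:
  assumes "P \<subseteq> carrier_vec n" and "affine_fun n f" and "v \<in> P"
    and le: "\<And>x. x \<in> P \<Longrightarrow> f x \<le> f v" and eq: "\<And>x. x \<in> P \<Longrightarrow> f x = f v \<Longrightarrow> x = v"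
  shows "vertex_of v P"
  unfolding vertex_of_def
proof (intro conjI ballI notI)
  show "v \<in> P" by fact
  fix x y assume xy: "x \<in> P" "y \<in> P" "v \<in> open_seg x y"
  then obtain s where s: "0 < s" "s < 1" "v = (1 - s) \<cdot>\<^sub>v x + s \<cdot>\<^sub>v y" "v \<noteq> x" "v \<noteq> y"
    using assms(1) open_segE by (metis subsetD)
  have "f v = (1 - s) * f x + s * f y"
    using assms(1,2) xy s(3) unfolding affine_fun_def by (metis subsetD)
  moreover have "f x < f v" "f y < f v"
    using le[OF xy(1)] le[OF xy(2)] eq[OF xy(1)] eq[OF xy(2)] s(4,5) by fastforce+
  then have "(1 - s) * f x + s * f y < (1 - s) * f v + s * f v"
    using s(1,2) by (intro add_strict_mono mult_strict_left_mono) auto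
  ultimately show False by (simp add: algebra_simps)
qed

text \<open>A mean with positive weights of two values that are at most \<open>m\<close> equals
  \<open>m\<close> only if both values do.\<close>

lemma vec_face_ofI:
  assumes "P \<subseteq> carrier_vec n" and "affine_fun n f" and "convex_vecs P"
    and le: "\<And>x. x \<in> P \<Longrightarrow> f x \<le> m"
  shows "vec_face_of {x \<in> P. f x = m} P"
  unfolding vec_face_of_def
proof (intro conjI ballI impI)
  have aff: "f ((1 - s) \<cdot>\<^sub>v x + s \<cdot>\<^sub>v y) = (1 - s) * f x + s * f y" if "x \<in> P" "y \<in> P" for x y s
    using that assms(1,2) unfolding affine_fun_def by (metis subsetD)
  show "convex_vecs {x \<in> P. f x = m}"
    unfolding convex_vecs_def
  proof (intro ballI subsetI)
    fix x y z assume x: "x \<in> {x \<in> P. f x = m}" and y: "y \<in> {x \<in> P. f x = m}"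
      and z: "z \<in> closed_seg x y"
    from z obtain s where "z = (1 - s) \<cdot>\<^sub>v x + s \<cdot>\<^sub>v y" unfolding closed_seg_def by auto
    then have "f z = m" using aff[of x y s] x y by (simp add: algebra_simps)
    moreover have "z \<in> P" using assms(3) x y z unfolding convex_vecs_def by blast
    ultimately show "z \<in> {x \<in> P. f x = m}" by simp
  qed
  fix x y z assume xy: "x \<in> P" "y \<in> P" and z: "z \<in> {x \<in> P. f x = m}" "z \<in> open_seg x y"
  obtain s where s: "0 < s" "s < 1" "z = (1 - s) \<cdot>\<^sub>v x + s \<cdot>\<^sub>v y"
    using assms(1) xy z open_segE by (metis subsetD)
  have "(1 - s) * (m - f x) + s * (m - f y) = 0"
    using aff[OF xy, of s] s(3) z(1) by (simp add: algebra_simps)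
  moreover have "0 \<le> (1 - s) * (m - f x)" "0 \<le> s * (m - f y)" using le xy s by simp_all
  ultimately have "(1 - s) * (m - f x) = 0" "s * (m - f y) = 0" by linarith+
  then show "x \<in> {x \<in> P. f x = m}" "y \<in> {x \<in> P. f x = m}" using s xy by simp_all
qed simp

text \<open>The segment is recovered as the full set of maximisers of \<open>f\<close>, which
  reduces adjacency to linear arithmetic with an explicit functional.\<close>

lemma adjacent_verticesI:
  assumes "P \<subseteq> carrier_vec n" and "affine_fun n f" and "convex_vecs P"
    and "vertex_of v P" and "vertex_of w P" and "v \<noteq> w" and "f v = f w"
    and le: "\<And>x. x \<in> P \<Longrightarrow> f x \<le> f w"
    and eq: "\<And>x. x \<in> P \<Longrightarrow> f x = f w \<Longrightarrow> x \<in> closed_seg v w"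
  shows "adjacent_vertices P v w"
proof -
  have vw: "v \<in> P" "w \<in> P" using assms(4,5) unfolding vertex_of_def by auto
  have "f x = f w" if x: "x \<in> closed_seg v w" for x
  proof -
    obtain s where "x = (1 - s) \<cdot>\<^sub>v v + s \<cdot>\<^sub>v w" using x unfolding closed_seg_def by auto
    then have "f x = (1 - s) * f v + s * f w"
      using assms(1,2) vw unfolding affine_fun_def by blast
    then show ?thesis using assms(7) by (simp add: algebra_simps)
  qed
  moreover have "closed_seg v w \<subseteq> P" using assms(3) vw unfolding convex_vecs_def by blast
  ultimately have "closed_seg v w = {x \<in> P. f x = f w}" using eq by blast
  then show ?thesis
    using vec_face_ofI[OF assms(1-3) le] assms(4-6) unfolding adjacent_vertices_def by simp
qed

lemma polyhedron_of_subset: "polyhedron_of A B b d \<subseteq> carrier_vec (dim_col A)"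
  unfolding polyhedron_of_def by auto

lemma convex_polyhedron_of:
  assumes "polyhedron_data n A B b d"
  shows "convex_vecs (polyhedron_of A B b d)"
  unfolding convex_vecs_def
proof (intro ballI subsetI)
  fix x y z
  assume xy: "x \<in> polyhedron_of A B b d" "y \<in> polyhedron_of A B b d" and "z \<in> closed_seg x y"
  then obtain s where s: "0 \<le> s" "s \<le> 1" and z: "z = (1 - s) \<cdot>\<^sub>v x + s \<cdot>\<^sub>v y"
    unfolding closed_seg_def by auto
  have A: "rmat A \<in> carrier_mat (dim_vec b) n" and B: "rmat B \<in> carrier_mat (dim_vec d) n"
    using assms unfolding polyhedron_data_def by auto
  have n: "dim_col A = n" using A by auto
  have x: "x \<in> carrier_vec n" "rmat A *\<^sub>v x = b" "rmat B *\<^sub>v x \<le> d"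
    and y: "y \<in> carrier_vec n" "rmat A *\<^sub>v y = b" "rmat B *\<^sub>v y \<le> d"
    using xy n unfolding polyhedron_of_def by auto
  have "rmat A *\<^sub>v z = (1 - s) \<cdot>\<^sub>v b + s \<cdot>\<^sub>v b"
    using x y unfolding z by (simp add: mult_add_distrib_mat_vec[OF A] mult_mat_vec[OF A])
  then have "rmat A *\<^sub>v z = b" by (auto intro!: eq_vecI simp: algebra_simps)
  moreover have "rmat B *\<^sub>v z = (1 - s) \<cdot>\<^sub>v (rmat B *\<^sub>v x) + s \<cdot>\<^sub>v (rmat B *\<^sub>v y)"
    using x y unfolding z by (simp add: mult_add_distrib_mat_vec[OF B] mult_mat_vec[OF B])
  then have "rmat B *\<^sub>v z \<le> d"
    using x(3) y(3) B s unfolding less_eq_vec_def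
    by (auto intro!: convex_bound_le simp del: index_mult_mat_vec)
  moreover have "z \<in> carrier_vec n" using x y unfolding z by auto
  ultimately show "z \<in> polyhedron_of A B b d" unfolding polyhedron_of_def using n by simp
qed

subsection \<open>Circuits\<close>

text \<open>By \<open>par\<close> the rows on which \<open>B g\<close> vanishes determine
  \<open>g\<close> up to a scalar. A nonzero kernel vector of smaller support would thus be a
  nonzero multiple of \<open>g\<close>, whose support is the same.\<close>

lemma circuitI:
  assumes "B \<in> carrier_mat m (dim_col A)" and "rvec g \<in> mat_kernel (rmat A)" and "g \<noteq> 0\<^sub>v (dim_col A)"
    and "Gcd (set\<^sub>v g) = 1"
    and par: "\<And>z. z \<in> carrier_vec (dim_col A) \<Longrightarrow>
      (\<And>i. i < m \<Longrightarrow> (rmat B *\<^sub>v rvec g) $ i = 0 \<Longrightarrow> (rmat B *\<^sub>v z) $ i = 0) \<Longrightarrow> \<exists>c. z = c \<cdot>\<^sub>v rvec g"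
  shows "circuit A B g"
  unfolding circuit_def
proof (intro conjI notI)
  let ?n = "dim_col A"
  have B: "rmat B \<in> carrier_mat m ?n" using assms(1) by simp
  have g: "g \<in> carrier_vec ?n" using assms(2) unfolding mat_kernel_def by auto
  have "rvec g \<noteq> 0\<^sub>v ?n"
  proof
    assume "rvec g = 0\<^sub>v ?n"
    then have "g $ i = 0" if "i < ?n" for i
      using that g by (metis carrier_vecD index_map_vec(1) index_zero_vec(1) of_int_eq_0_iff)
    then have "g = 0\<^sub>v ?n" using g by (intro eq_vecI) auto
    then show False using assms(3) by simp
  qed
  then show "rvec g \<in> mat_kernel (rmat A) - {0\<^sub>v ?n}" using assms(2) by simp
  assume "\<exists>z\<in>mat_kernel (rmat A) - {0\<^sub>v ?n}. supp (rmat B *\<^sub>v z) \<subset> supp (rmat B *\<^sub>v rvec g)"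
  then obtain z where z: "z \<in> carrier_vec ?n" "z \<noteq> 0\<^sub>v ?n"
    and ss: "supp (rmat B *\<^sub>v z) \<subset> supp (rmat B *\<^sub>v rvec g)"
    unfolding mat_kernel_def by auto
  obtain c where c: "z = c \<cdot>\<^sub>v rvec g"
    using par[OF z(1)] ss B unfolding supp_def by (auto simp del: index_mult_mat_vec)
  have "c \<noteq> 0" using z c g by auto
  moreover have "rmat B *\<^sub>v z = c \<cdot>\<^sub>v (rmat B *\<^sub>v rvec g)"
    unfolding c using g by (simp add: mult_mat_vec[OF B])
  ultimately have "supp (rmat B *\<^sub>v z) = supp (rmat B *\<^sub>v rvec g)"
    unfolding supp_def by (auto simp del: index_mult_mat_vec)
  then show False using ss by simp
qed (fact assms(4))

subsection \<open>Sign-compatible walks\<close>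

lemma circuit_walk_Suc:
  assumes "circuit_walk A B v1 v2 k y g \<alpha>" and "i < k"
  shows "y (Suc i) = y i + \<alpha> i \<cdot>\<^sub>v rvec (g i)"
proof -
  have "y (Suc i) \<in> carrier_vec (dim_col A)" "y i \<in> carrier_vec (dim_col A)"
    and eq: "y (Suc i) - y i = \<alpha> i \<cdot>\<^sub>v rvec (g i)"
    using assms unfolding circuit_walk_def by auto
  then show ?thesis unfolding eq[symmetric] by (intro eq_vecI) auto
qed

lemma circuit_carrier: "circuit A B g \<Longrightarrow> g \<in> carrier_vec (dim_col A)"
  unfolding circuit_def mat_kernel_def by auto

text \<open>Otherwise the whole line through \<open>v\<close> in direction \<open>g\<close> stays in
  the polyhedron, and \<open>v\<close> is the midpoint of \<open>v + g\<close> and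
  \<open>v - g\<close>.\<close>

lemma vertex_imp_circuit_image_nonzero:
  assumes "polyhedron_data n A B b d" and "vertex_of v (polyhedron_of A B b d)" and "circuit A B g"
  shows "rmat B *\<^sub>v rvec g \<noteq> 0\<^sub>v (dim_row B)"
proof
  assume Bg: "rmat B *\<^sub>v rvec g = 0\<^sub>v (dim_row B)"
  let ?g = "rvec g"
  have A: "rmat A \<in> carrier_mat (dim_vec b) n" and B: "rmat B \<in> carrier_mat (dim_vec d) n"
    using assms(1) unfolding polyhedron_data_def by auto
  have g: "?g \<in> carrier_vec n" and Ag: "rmat A *\<^sub>v ?g = 0\<^sub>v (dim_vec b)" and g0: "?g \<noteq> 0\<^sub>v n"
    using assms(3) A unfolding circuit_def mat_kernel_def by auto
  have v: "v \<in> carrier_vec n" "rmat A *\<^sub>v v = b" "rmat B *\<^sub>v v \<le> d"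
    using assms(2) A unfolding vertex_of_def polyhedron_of_def by auto
  have mem: "v + s \<cdot>\<^sub>v ?g \<in> polyhedron_of A B b d" for s
  proof -
    have "rmat A *\<^sub>v (v + s \<cdot>\<^sub>v ?g) = b + s \<cdot>\<^sub>v 0\<^sub>v (dim_vec b)"
      using v(1,2) g Ag by (simp add: mult_add_distrib_mat_vec[OF A] mult_mat_vec[OF A])
    moreover have "rmat B *\<^sub>v (v + s \<cdot>\<^sub>v ?g) = rmat B *\<^sub>v v + s \<cdot>\<^sub>v 0\<^sub>v (dim_row B)"
      using v(1) g Bg by (simp add: mult_add_distrib_mat_vec[OF B] mult_mat_vec[OF B])
    moreover have "rmat B *\<^sub>v v + s \<cdot>\<^sub>v 0\<^sub>v (dim_row B) = rmat B *\<^sub>v v"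
      "b + s \<cdot>\<^sub>v 0\<^sub>v (dim_vec b) = b"
      by (intro eq_vecI; simp del: index_mult_mat_vec)+
    ultimately show ?thesis using v g A unfolding polyhedron_of_def by simp
  qed
  have ne: "v \<noteq> v + s \<cdot>\<^sub>v ?g" if "s \<noteq> 0" for s
  proof
    assume eq: "v = v + s \<cdot>\<^sub>v ?g"
    have "?g $ i = 0" if "i < n" for i
      using arg_cong[OF eq, of "\<lambda>u. u $ i"] that v(1) g \<open>s \<noteq> 0\<close> by auto
    then have "?g = 0\<^sub>v n" using g by (intro eq_vecI) auto
    then show False using g0 by simp
  qed
  have "v = (1 - 1/2) \<cdot>\<^sub>v (v + 1 \<cdot>\<^sub>v ?g) + (1/2) \<cdot>\<^sub>v (v + (-1) \<cdot>\<^sub>v ?g)"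
    using v(1) g by (intro eq_vecI) (auto simp: field_simps)
  then have "v \<in> closed_seg (v + 1 \<cdot>\<^sub>v ?g) (v + (-1) \<cdot>\<^sub>v ?g)"
    unfolding closed_seg_def by (intro CollectI exI[of _ "1/2"] conjI) (assumption, simp_all (no_asm))
  moreover have "v \<noteq> v + 1 \<cdot>\<^sub>v ?g" "v \<noteq> v + (-1) \<cdot>\<^sub>v ?g" by (rule ne, simp)+
  ultimately have "v \<in> open_seg (v + 1 \<cdot>\<^sub>v ?g) (v + (-1) \<cdot>\<^sub>v ?g)"
    unfolding open_seg_def by blast
  then show False using assms(2) mem unfolding vertex_of_def by blast
qed

text \<open>For opposite circuits the product in each row is minus a square, so \<open>B\<close>
  would map the circuit to 0.\<close>

lemma sign_compatible_imp_non_backwards: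
  assumes "polyhedron_data n A B b d" and "vertex_of v1 (polyhedron_of A B b d)"
    and "circuit_walk A B v1 v2 k y g \<alpha>"
    and "has_property SignCompatible A B b d v1 v2 k y g \<alpha>"
  shows "has_property NonBackwards A B b d v1 v2 k y g \<alpha>"
  unfolding has_property.simps
proof (intro allI impI notI)
  fix i j assume ij: "i < k" "j < k" and gj: "g j = - g i"
  have circ: "circuit A B (g i)" using assms(3) ij unfolding circuit_walk_def by simp
  have dB: "rmat B \<in> carrier_mat (dim_row B) (dim_col A)"
    using assms(1) unfolding polyhedron_data_def by auto
  have gi: "rvec (g i) \<in> carrier_vec (dim_col A)" using circuit_carrier[OF circ] by simp
  have "rvec (g j) = (-1) \<cdot>\<^sub>v rvec (g i)"
    unfolding gj using circuit_carrier[OF circ] by (intro eq_vecI) auto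
  then have eq: "rmat B *\<^sub>v rvec (g j) = (-1) \<cdot>\<^sub>v (rmat B *\<^sub>v rvec (g i))"
    using mult_mat_vec[OF dB gi] by simp
  have "(rmat B *\<^sub>v rvec (g i)) $ l = 0" if l: "l < dim_row B" for l
  proof -
    have "0 \<le> (rmat B *\<^sub>v rvec (g i)) $ l * (rmat B *\<^sub>v rvec (g j)) $ l"
      using assms(4) l ij unfolding has_property.simps by blast
    then have "0 \<le> - ((rmat B *\<^sub>v rvec (g i)) $ l)\<^sup>2"
      unfolding eq using l by (simp add: power2_eq_square del: index_mult_mat_vec)
    then show ?thesis by simp
  qed
  then have "rmat B *\<^sub>v rvec (g i) = 0\<^sub>v (dim_row B)"
    by (intro eq_vecI) (auto simp del: index_mult_mat_vec)
  then show False using vertex_imp_circuit_image_nonzero[OF assms(1,2) circ] by simp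
qed

text \<open>
  Two steps along the same circuit can be carried out at the earlier position: in each row the
  walk moves monotonically, so advancing a step does not leave the polyhedron.
\<close>

lemma sign_compatible_merge:
  assumes data: "polyhedron_data n A B b d"
    and walk: "circuit_walk A B v1 v2 k y g \<alpha>"
    and feas: "has_property Feasible A B b d v1 v2 k y g \<alpha>"
    and sign: "has_property SignCompatible A B b d v1 v2 k y g \<alpha>"
    and ij: "i < j" "j < k" "g i = g j"
  obtains y' g' \<alpha>' where "circuit_walk A B v1 v2 (k - 1) y' g' \<alpha>'"
    and "has_property Feasible A B b d v1 v2 (k - 1) y' g' \<alpha>'"
    and "has_property SignCompatible A B b d v1 v2 (k - 1) y' g' \<alpha>'"
proof -
  let ?c = "\<alpha> j \<cdot>\<^sub>v rvec (g j)"
  \<comment> \<open>Step \<open>j\<close> is dropped and its shift \<open>?c\<close> is applied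
    right after position \<open>i\<close>. At \<open>m = j\<close> the shifted point is already
    \<open>y (Suc j)\<close>, so the tail joins on with indices moved by one.\<close>
  define y' where "y' m = (if m \<le> i then y m else if m \<le> j then y m + ?c else y (Suc m))" for m
  define g' where "g' m = (if m < j then g m else g (Suc m))" for m
  define \<alpha>' where "\<alpha>' m = (if m = i then \<alpha> i + \<alpha> j else if m < j then \<alpha> m else \<alpha> (Suc m))" for m
  have A: "rmat A \<in> carrier_mat (dim_vec b) n" and B: "rmat B \<in> carrier_mat (dim_vec d) n"
    using data unfolding polyhedron_data_def by auto
  have dA: "dim_col A = n" using A by auto
  have yc: "y m \<in> carrier_vec n" if "m \<le> k" for m
    using walk that dA unfolding circuit_walk_def by auto
  have circ: "circuit A B (g m)" and pos: "0 < \<alpha> m" if "m < k" for m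
    using walk that unfolding circuit_walk_def by auto
  have gc: "g m \<in> carrier_vec n" if "m < k" for m
    using circuit_carrier[OF circ[OF that]] dA by simp
  have step: "y (Suc m) = y m + \<alpha> m \<cdot>\<^sub>v rvec (g m)" if "m < k" for m
    using circuit_walk_Suc[OF walk that] .
  have Bstep: "(rmat B *\<^sub>v y (Suc m)) $ l = (rmat B *\<^sub>v y m) $ l + \<alpha> m * (rmat B *\<^sub>v rvec (g m)) $ l"
    if "m < k" "l < dim_row B" for m l
    unfolding step[OF that(1)] using yc[of m] gc[OF that(1)] that
    by (simp add: mult_add_distrib_mat_vec[OF B] mult_mat_vec[OF B] del: index_mult_mat_vec)
  have P: "y m \<in> polyhedron_of A B b d" if "m \<le> k" for m
    using feas that by simp
  have advanced: "y m + ?c \<in> polyhedron_of A B b d" if "m \<le> j" for m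
    unfolding polyhedron_of_def less_eq_vec_def
  proof (intro CollectI conjI allI impI)
    have m: "y m \<in> carrier_vec n" and c: "rvec (g j) \<in> carrier_vec n"
      using yc[of m] gc[of j] that ij by auto
    show "y m + ?c \<in> carrier_vec (dim_col A)" using m c dA by simp
    have "rmat A *\<^sub>v y m = b" using P[of m] that ij unfolding polyhedron_of_def by simp
    moreover have "rmat A *\<^sub>v rvec (g j) = 0\<^sub>v (dim_vec b)"
      using circ[of j] ij A unfolding circuit_def mat_kernel_def by auto
    ultimately show "rmat A *\<^sub>v (y m + ?c) = b"
      using m c by (auto simp: mult_add_distrib_mat_vec[OF A] mult_mat_vec[OF A])
    show "dim_vec (rmat B *\<^sub>v (y m + ?c)) = dim_vec d" using B by simp
    fix l assume "l < dim_vec d"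
    then have l: "l < dim_row B" using B by auto
    have le: "(rmat B *\<^sub>v y m') $ l \<le> d $ l" if "m' \<le> k" for m'
      using P[OF that] \<open>l < dim_vec d\<close> unfolding polyhedron_of_def less_eq_vec_def by blast
    have "(rmat B *\<^sub>v (y m + ?c)) $ l = (rmat B *\<^sub>v y m) $ l + \<alpha> j * (rmat B *\<^sub>v rvec (g j)) $ l"
      using m c l
      by (simp add: mult_add_distrib_mat_vec[OF B] mult_mat_vec[OF B] del: index_mult_mat_vec)
    also have "\<dots> \<le> d $ l"
    \<comment> \<open>A row that does not increase along \<open>g j\<close> cannot be violated by
      the shift. In a row that does increase, every step of the walk is nonnegative, so the shifted
      value at \<open>m\<close> is at most the one at \<open>j\<close>, which is the value at the
      feasible point \<open>y (Suc j)\<close>.\<close>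
    proof (cases "(rmat B *\<^sub>v rvec (g j)) $ l \<le> 0")
      case True
      then have "\<alpha> j * (rmat B *\<^sub>v rvec (g j)) $ l \<le> 0"
        using pos[of j] ij by (simp add: mult_nonneg_nonpos del: index_mult_mat_vec)
      then show ?thesis using le[of m] that ij by linarith
    next
      case False
      have nonneg: "0 \<le> (rmat B *\<^sub>v rvec (g m')) $ l" if "m' < k" for m'
      proof -
        have "0 \<le> (rmat B *\<^sub>v rvec (g m')) $ l * (rmat B *\<^sub>v rvec (g j)) $ l"
          using sign l that ij unfolding has_property.simps by blast
        then show ?thesis using False by (simp add: zero_le_mult_iff del: index_mult_mat_vec)
      qed
      have "(rmat B *\<^sub>v y m) $ l \<le> (rmat B *\<^sub>v y j) $ l"
        using that
      proof (induction rule: inc_induct)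
        case (step m')
        have "0 \<le> \<alpha> m' * (rmat B *\<^sub>v rvec (g m')) $ l"
          using pos[of m'] nonneg[of m'] step.hyps ij by simp
        then show ?case using step Bstep[of m' l] l ij by simp
      qed simp
      then show ?thesis using Bstep[of j l] le[of "Suc j"] l ij by simp
    qed
    finally show "(rmat B *\<^sub>v (y m + ?c)) $ l \<le> d $ l" .
  qed
  have walk': "circuit_walk A B v1 v2 (k - 1) y' g' \<alpha>'"
    unfolding circuit_walk_def
  proof (intro conjI allI impI)
    show "y' 0 = v1" using walk unfolding y'_def circuit_walk_def by simp
    show "y' (k - 1) = v2"
    proof (cases "k - 1 = j")
      case True
      then show ?thesis using step[of j] walk ij unfolding y'_def circuit_walk_def by auto
    next
      case False
      then show ?thesis using walk ij unfolding y'_def circuit_walk_def by auto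
    qed
    show "y' m \<in> carrier_vec (dim_col A)" if "m \<le> k - 1" for m
      using that yc[of m] yc[of "Suc m"] gc[of j] ij dA unfolding y'_def by auto
    fix m assume m: "m < k - 1"
    show "circuit A B (g' m)" using circ[of m] circ[of "Suc m"] m unfolding g'_def by auto
    show "0 < \<alpha>' m" using pos[of m] pos[of "Suc m"] pos[of i] pos[of j] m ij unfolding \<alpha>'_def by auto
    have car: "y m \<in> carrier_vec n" "rvec (g m) \<in> carrier_vec n" "rvec (g (Suc m)) \<in> carrier_vec n"
      "rvec (g j) \<in> carrier_vec n"
      using yc[of m] gc[of m] gc[of "Suc m"] gc[of j] m ij by auto
    have st: "y (Suc m) = y m + \<alpha> m \<cdot>\<^sub>v rvec (g m)"
      "y (Suc (Suc m)) = y m + \<alpha> m \<cdot>\<^sub>v rvec (g m) + \<alpha> (Suc m) \<cdot>\<^sub>v rvec (g (Suc m))"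
      using step[of m] step[of "Suc m"] m by auto
    consider "m < i" | "m = i" | "i < m" "m < j" | "m = j" | "j < m" by linarith
    then show "y' (Suc m) - y' m = \<alpha>' m \<cdot>\<^sub>v rvec (g' m)"
      by cases (use car st ij in \<open>auto simp: y'_def g'_def \<alpha>'_def algebra_simps intro!: eq_vecI\<close>)
  qed
  have feas': "has_property Feasible A B b d v1 v2 (k - 1) y' g' \<alpha>'"
    using P advanced ij unfolding y'_def by auto
  have "\<exists>m'<k. g' m = g m'" if "m < k - 1" for m
    using that unfolding g'_def by (cases "m < j") (auto intro: exI[of _ m] exI[of _ "Suc m"])
  then have sign': "has_property SignCompatible A B b d v1 v2 (k - 1) y' g' \<alpha>'"
    using sign unfolding has_property.simps by metis
  show ?thesis by (rule that[OF walk' feas' sign'])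
qed

text \<open>Each merge removes one step and keeps both properties, so strong induction on the length
  ends at a non-repetitive walk that is no longer than the given one.\<close>

lemma sign_compatible_imp_non_repetitive:
  assumes data: "polyhedron_data n A B b d" and v1: "vertex_of v1 (polyhedron_of A B b d)"
    and "circuit_walk A B v1 v2 k y g \<alpha>"
    and "has_property Feasible A B b d v1 v2 k y g \<alpha>"
    and "has_property SignCompatible A B b d v1 v2 k y g \<alpha>"
  shows "CD {Feasible, NonBackwards, NonRepetitive} A B b d v1 v2 \<le> enat k"
  using assms(3-5)
proof (induction k arbitrary: y g \<alpha> rule: less_induct)
  case (less k)
  show ?case
  proof (cases "has_property NonRepetitive A B b d v1 v2 k y g \<alpha>")
    case True
    then show ?thesis
      using less.prems sign_compatible_imp_non_backwards[OF data v1 less.prems(1,3)]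
      by (intro CD_le[OF less.prems(1)]) auto
  next
    case False
    then obtain i j where ij: "i < k" "j < k" "i \<noteq> j" "g i = g j" by auto
    then have "min i j < max i j" "max i j < k" "g (min i j) = g (max i j)"
      by (auto simp: min_def max_def)
    from sign_compatible_merge[OF data less.prems this] obtain y' g' \<alpha>'
      where "circuit_walk A B v1 v2 (k - 1) y' g' \<alpha>'"
      "has_property Feasible A B b d v1 v2 (k - 1) y' g' \<alpha>'"
      "has_property SignCompatible A B b d v1 v2 (k - 1) y' g' \<alpha>'" .
    then have "CD {Feasible, NonBackwards, NonRepetitive} A B b d v1 v2 \<le> enat (k - 1)"
      using ij by (intro less.IH) auto
    also have "\<dots> \<le> enat k" by simp
    finally show ?thesis .
  qed
qed

lemma CD_fs_ge_CD_fbr: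
  "CD {Feasible, SignCompatible} \<ge>\<^sub>C\<^sub>D CD {Feasible, NonBackwards, NonRepetitive}"
  unfolding cd_ge_def
proof (intro allI impI)
  fix n A B b d v1 v2
  assume "polyhedron_data n A B b d" "vertex_of v1 (polyhedron_of A B b d)"
  then show "CD {Feasible, NonBackwards, NonRepetitive} A B b d v1 v2
    \<le> CD {Feasible, SignCompatible} A B b d v1 v2"
    unfolding CD_def[of "{Feasible, SignCompatible}"]
    by (intro INF_greatest) (auto intro: sign_compatible_imp_non_repetitive)
qed

subsection \<open>A family of five-dimensional polyhedra\<close>

lemma ball_1_4: "(\<forall>j\<in>{1..4::nat}. Q j) \<longleftrightarrow> Q 1 \<and> Q 2 \<and> Q 3 \<and> Q 4"
proof -
  have "{1..4::nat} = {1, 2, 3, 4}" by auto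
  then show ?thesis by simp
qed

lemma All_less_3: "(\<forall>i<3::nat. Q i) \<longleftrightarrow> Q 0 \<and> Q 1 \<and> Q 2"
  by (auto simp: less_Suc_eq numeral_eq_Suc)

lemma All_le_3: "(\<forall>i\<le>3::nat. Q i) \<longleftrightarrow> Q 0 \<and> Q 1 \<and> Q 2 \<and> Q 3"
  by (auto simp: le_Suc_eq numeral_eq_Suc)

lemma All_less_2: "(\<forall>i<2::nat. Q i) \<longleftrightarrow> Q 0 \<and> Q 1"
  by (auto simp: less_Suc_eq numeral_eq_Suc)

lemma All_le_2: "(\<forall>i\<le>2::nat. Q i) \<longleftrightarrow> Q 0 \<and> Q 1 \<and> Q 2"
  by (auto simp: le_Suc_eq numeral_eq_Suc)

text \<open>
  Write \<open>t = z $ 0\<close>, \<open>q\<^sub>j = z $ j\<close> and \<open>p\<^sub>j = q\<^sub>j + t\<close> for \<open>j = 1, \<dots>, 4\<close>. The constraints are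
  \<open>0 \<le> p\<^sub>j \<le> 2\<close>, \<open>0 \<le> q\<^sub>j \<le> 2\<close> and \<open>- a \<le> t \<le> c\<close>, so the polyhedron consists of four copies of
  a polygon in the \<open>(p, q)\<close>-plane, coupled by the common value of \<open>p - q\<close>.
\<close>

definition coupled_form :: "nat \<Rightarrow> 'a::comm_ring_1 vec \<Rightarrow> 'a" where
  "coupled_form r z = (if r = 0 then z $ 0 else if r \<le> 4 then z $ r else z $ (r - 4) + z $ 0)"

text \<open>Rows 0 to 8 are the nine forms, rows 9 to 17 their negatives. Coefficients are read off
  by applying a form to unit vectors; \<open>coupled_form\<close> is polymorphic so that one formula
  yields both the integer entries and the values at real points.\<close>

definition coupled_B :: "int mat" where
  "coupled_B = mat 18 5 (\<lambda>(r, c). (if r < 9 then 1 else -1) *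
     coupled_form (r mod 9) (vec 5 (\<lambda>i. if i = c then 1 else 0)))"

definition coupled_d :: "real \<Rightarrow> real \<Rightarrow> real vec" where
  "coupled_d a c = vec 18 (\<lambda>r. if r = 0 then c else if r < 9 then 2 else if r = 9 then a else 0)"

abbreviation coupled_A :: "int mat" where "coupled_A \<equiv> 0\<^sub>m 0 5"

definition no_rhs :: "real vec" where "no_rhs = 0\<^sub>v 0"

abbreviation coupled_P :: "real \<Rightarrow> real \<Rightarrow> real vec set" where
  "coupled_P a c \<equiv> polyhedron_of coupled_A coupled_B no_rhs (coupled_d a c)"

lemma coupled_B_carrier: "coupled_B \<in> carrier_mat 18 5" "dim_row coupled_B = 18" "dim_col coupled_B = 5"
  unfolding coupled_B_def by auto

lemma less_18_iff: "r < (18::nat) \<longleftrightarrow> r \<in> {0,1,2,3,4,5,6,7,8,9,10,11,12,13,14,15,16,17}"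
  by (simp only: insert_iff empty_iff simp_thms) presburger

lemma coupled_form_expand:
  assumes "r < 9"
  shows "(\<Sum>c = 0..<5. real_of_int (coupled_form r (vec 5 (\<lambda>i. if i = c then 1 else 0))) * z $ c) = coupled_form r z"
proof -
  have delta: "(\<Sum>c = 0..<5. real_of_int (if k = c then 1 else 0) * z $ c) = z $ k" if "k < 5" for k
  proof -
    have "(\<Sum>c = 0..<5. real_of_int (if k = c then 1 else 0) * z $ c)
      = (\<Sum>c = 0..<5. if k = c then z $ c else 0)" by (intro sum.cong) auto
    then show ?thesis using that by simp
  qed
  show ?thesis
    using delta[of 0] delta[of r] delta[of "r - 4"] assms
    by (auto simp: coupled_form_def distrib_right sum.distrib)
qed

lemma coupled_B_mult:
  assumes "z \<in> carrier_vec 5" and "r < 18"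
  shows "(rmat coupled_B *\<^sub>v z) $ r = (if r < 9 then 1 else -1) * coupled_form (r mod 9) z"
proof -
  have "(rmat coupled_B *\<^sub>v z) $ r = (\<Sum>c = 0..<5. (if r < 9 then 1 else -1) *
    (real_of_int (coupled_form (r mod 9) (vec 5 (\<lambda>i. if i = c then 1 else 0))) * z $ c))"
    using assms coupled_B_carrier by (auto simp: scalar_prod_def coupled_B_def intro!: sum.cong)
  then show ?thesis using coupled_form_expand[of "r mod 9" z] by (simp flip: sum_distrib_left)
qed

lemma polyhedron_data_coupled: "polyhedron_data 5 coupled_A coupled_B no_rhs (coupled_d a c)"
  unfolding polyhedron_data_def coupled_d_def no_rhs_def using coupled_B_carrier by simp

lemma mem_coupled_P:
  "z \<in> coupled_P a c \<longleftrightarrow> z \<in> carrier_vec 5 \<and> - a \<le> z $ 0 \<and> z $ 0 \<le> c \<and>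
    (\<forall>j\<in>{1..4}. 0 \<le> z $ j \<and> z $ j \<le> 2 \<and> 0 \<le> z $ j + z $ 0 \<and> z $ j + z $ 0 \<le> 2)"
proof (cases "z \<in> carrier_vec 5")
  case True
  have "rmat coupled_B *\<^sub>v z \<le> coupled_d a c \<longleftrightarrow>
    (\<forall>r<18. (if r < 9 then 1 else -1) * coupled_form (r mod 9) z \<le> coupled_d a c $ r)"
    unfolding less_eq_vec_def using coupled_B_mult[OF True] coupled_B_carrier
    by (auto simp: coupled_d_def simp del: index_mult_mat_vec)
  also have "\<dots> \<longleftrightarrow> (\<forall>r\<in>{0,1,2,3,4,5,6,7,8,9,10,11,12,13,14,15,16,17}.
    (if r < 9 then 1 else -1) * coupled_form (r mod 9) z \<le> coupled_d a c $ r)"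
    unfolding Ball_def less_18_iff ..
  also have "\<dots> \<longleftrightarrow> - a \<le> z $ 0 \<and> z $ 0 \<le> c \<and>
    (\<forall>j\<in>{1..4}. 0 \<le> z $ j \<and> z $ j \<le> 2 \<and> 0 \<le> z $ j + z $ 0 \<and> z $ j + z $ 0 \<le> 2)"
    unfolding ball_1_4 by (simp add: coupled_form_def coupled_d_def) linarith
  finally show ?thesis using True unfolding polyhedron_of_def no_rhs_def by (auto intro!: eq_vecI)
qed (simp add: polyhedron_of_def)

lemma coupled_P_memD:
  assumes "z \<in> coupled_P a c"
  shows "- a \<le> z $ 0" "z $ 0 \<le> c"
    and "\<And>j. j \<in> {1..4} \<Longrightarrow> 0 \<le> z $ j \<and> z $ j \<le> 2 \<and> 0 \<le> z $ j + z $ 0 \<and> z $ j + z $ 0 \<le> 2"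
  using assms unfolding mem_coupled_P by blast+

lemma vec5_eqI:
  assumes "u \<in> carrier_vec 5" "w \<in> carrier_vec 5" "u $ 0 = w $ 0"
    and "\<And>j. j \<in> {1..4} \<Longrightarrow> u $ j = w $ j"
  shows "u = w"
proof (rule eq_vecI)
  fix i assume "i < dim_vec w"
  then have "i = 0 \<or> i \<in> {1..4}" using assms(2) by auto
  then show "u $ i = w $ i" using assms(3,4) by auto
qed (use assms in auto)

section \<open>Circuits of the coupled family\<close>

lemma coupled_circuit_minimal:
  fixes z :: "real vec"
  assumes "circuit coupled_A coupled_B g" and "z \<in> carrier_vec 5" and "z \<noteq> 0\<^sub>v 5"
    and sub: "\<And>r. r < 9 \<Longrightarrow> coupled_form r z \<noteq> 0 \<Longrightarrow> coupled_form r (rvec g) \<noteq> 0"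
    and r: "r < 9" "coupled_form r (rvec g) \<noteq> 0"
  shows "coupled_form r z \<noteq> 0"
proof
  assume z0: "coupled_form r z = 0"
  have g: "rvec g \<in> carrier_vec 5" using circuit_carrier[OF assms(1)] by simp
  \<comment> \<open>Rows \<open>r\<close> and \<open>r + 9\<close> vanish together, so supports can
    be compared on the nine forms alone.\<close>
  have supp: "supp (rmat coupled_B *\<^sub>v u) = {r. r < 18 \<and> coupled_form (r mod 9) u \<noteq> 0}"
    if "u \<in> carrier_vec 5" for u
    unfolding supp_def using coupled_B_mult[OF that] coupled_B_carrier
    by (auto simp del: index_mult_mat_vec split: if_splits)
  have "supp (rmat coupled_B *\<^sub>v z) \<subseteq> supp (rmat coupled_B *\<^sub>v rvec g)"
    using sub unfolding supp[OF assms(2)] supp[OF g] by auto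
  moreover have "r \<in> supp (rmat coupled_B *\<^sub>v rvec g) - supp (rmat coupled_B *\<^sub>v z)"
    using r z0 unfolding supp[OF assms(2)] supp[OF g] by auto
  ultimately have "supp (rmat coupled_B *\<^sub>v z) \<subset> supp (rmat coupled_B *\<^sub>v rvec g)" by auto
  moreover have "z \<in> mat_kernel (rmat coupled_A) - {0\<^sub>v 5}"
    using assms(2,3) unfolding mat_kernel_def by (auto intro!: eq_vecI)
  ultimately show False using assms(1) unfolding circuit_def by auto
qed

lemma Gcd_1_dvd_imp_abs_1:
  assumes "Gcd (set\<^sub>v g) = 1" and "\<And>x. x \<in> set\<^sub>v g \<Longrightarrow> (a::int) dvd x"
  shows "\<bar>a\<bar> = 1"
proof -
  have "a dvd Gcd (set\<^sub>v g)" using assms(2) by (rule Gcd_greatest)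
  then show ?thesis using assms(1) by simp
qed

lemma set_vec5: "g \<in> carrier_vec 5 \<Longrightarrow> set\<^sub>v g = insert (g $ 0) ((\<lambda>j. g $ j) ` {1..4})"
proof -
  assume "g \<in> carrier_vec 5"
  moreover have "{..<5::nat} = insert 0 {1..4}" by auto
  ultimately show ?thesis unfolding vec_set_def by auto
qed

text \<open>If \<open>t\<close> is unchanged, some unit vector has support inside that of
  \<open>g\<close>, so only one copy moves. If \<open>t\<close> changes, comparison with a vector
  that moves only one of \<open>p\<close> and \<open>q\<close> in each copy shows that
  \<open>g\<close> cannot move both. Coprimality then bounds the common factor.\<close>

lemma coupled_circuit_cases:
  assumes "circuit coupled_A coupled_B g"
  obtains (single) i where "i \<in> {1..4}" "g $ 0 = 0" "\<bar>g $ i\<bar> = 1"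
      "\<And>j. j \<in> {1..4} \<Longrightarrow> j \<noteq> i \<Longrightarrow> g $ j = 0"
  | (global) "\<bar>g $ 0\<bar> = 1" "\<And>j. j \<in> {1..4} \<Longrightarrow> g $ j = 0 \<or> g $ j = - g $ 0"
proof (cases "g $ 0 = 0")
  have g: "g \<in> carrier_vec 5" using circuit_carrier[OF assms] by simp
  have gcd: "Gcd (set\<^sub>v g) = 1" and "rvec g \<noteq> 0\<^sub>v 5" using assms unfolding circuit_def by auto
  have coupled_form_g: "coupled_form r (rvec g) = real_of_int (coupled_form r g)" if "r < 9" for r
    using g that unfolding coupled_form_def by auto
  {
    case True
    have "\<exists>i\<in>{1..4}. g $ i \<noteq> 0"
    proof (rule ccontr)
      assume "\<not> ?thesis"
      then have "rvec g = 0\<^sub>v 5" using g True by (intro vec5_eqI) auto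
      then show False using \<open>rvec g \<noteq> 0\<^sub>v 5\<close> by simp
    qed
    then obtain i where i: "i \<in> {1..4}" "g $ i \<noteq> 0" by auto
    let ?z = "vec 5 (\<lambda>j. if j = i then 1 else 0) :: real vec"
    have z: "?z $ 0 = 0" "\<And>j. j \<in> {1..4} \<Longrightarrow> ?z $ j = (if j = i then 1 else 0)"
      using i by auto
    have "?z \<noteq> 0\<^sub>v 5"
    proof
      assume "?z = 0\<^sub>v 5"
      then have "?z $ i = 0\<^sub>v 5 $ i" by simp
      then show False using i by simp
    qed
    have single: "g $ j = 0" if j: "j \<in> {1..4}" "j \<noteq> i" for j
    proof (rule ccontr)
      assume "g $ j \<noteq> 0"
      then have "coupled_form j ?z \<noteq> 0"
        using j i True g
        by (intro coupled_circuit_minimal[OF assms _ \<open>?z \<noteq> 0\<^sub>v 5\<close>])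
          (auto simp: coupled_form_g coupled_form_def split: if_splits)
      then show False using j z by (simp add: coupled_form_def)
    qed
    have "\<bar>g $ i\<bar> = 1"
      using single True by (intro Gcd_1_dvd_imp_abs_1[OF gcd]) (force simp: set_vec5[OF g])
    then show ?thesis using that(1) i True single by blast
  next
    case False
    \<comment> \<open>This vector changes \<open>t\<close> by 1, keeps \<open>p\<close> fixed in the
      copies where \<open>g\<close> does, and keeps \<open>q\<close> fixed in the others. Its
      support lies in that of \<open>g\<close>, and strictly so if \<open>g\<close> changes both
      \<open>p\<close> and \<open>q\<close> in some copy.\<close>
    let ?z = "vec 5 (\<lambda>j. if j = 0 then 1 else if g $ j + g $ 0 = 0 then -1 else 0) :: real vec"
    have z: "?z $ 0 = 1"
      "\<And>j. j \<in> {1..4} \<Longrightarrow> ?z $ j = (if g $ j + g $ 0 = 0 then -1 else 0)" by auto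
    have "?z \<noteq> 0\<^sub>v 5"
    proof
      assume "?z = 0\<^sub>v 5"
      then have "?z $ 0 = 0\<^sub>v 5 $ 0" by simp
      then show False by simp
    qed
    have global: "g $ j = 0 \<or> g $ j = - g $ 0" if j: "j \<in> {1..4}" for j
    proof (rule ccontr)
      assume neg: "\<not> ?thesis"
      then have "coupled_form j ?z \<noteq> 0"
        using j False g
        by (intro coupled_circuit_minimal[OF assms _ \<open>?z \<noteq> 0\<^sub>v 5\<close>])
          (auto simp: coupled_form_g coupled_form_def split: if_splits)
      then show False using j z neg by (auto simp: coupled_form_def split: if_splits)
    qed
    have "\<bar>g $ 0\<bar> = 1"
      using global by (intro Gcd_1_dvd_imp_abs_1[OF gcd]) (fastforce simp: set_vec5[OF g])
    then show ?thesis using that(2) global by blast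
  }
qed

section \<open>Points and directions on which the four copies agree\<close>

definition pt :: "'a \<Rightarrow> 'a \<Rightarrow> 'a vec" where
  "pt t q = vec 5 (\<lambda>i. if i = 0 then t else q)"

lemma pt_simps [simp]:
  "pt t q \<in> carrier_vec 5" "dim_vec (pt t q) = 5" "pt t q $ 0 = t"
  "j \<in> {1..4} \<Longrightarrow> pt t q $ j = q"
  unfolding pt_def by auto

lemma pt_add: "pt t q + pt t' q' = pt (t + t') (q + q')"
  unfolding pt_def by (intro eq_vecI) auto

lemma pt_diff: "pt t q - pt t' q' = pt (t - t') (q - q')"
  unfolding pt_def by (intro eq_vecI) auto

lemma pt_smult: "s \<cdot>\<^sub>v pt t q = pt (s * t) (s * q)"
  unfolding pt_def by (intro eq_vecI) auto

lemma pt_uminus: "- pt t q = pt (- t) (- q :: 'a :: ring_1)"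
  unfolding pt_def by (intro eq_vecI) auto

lemma rvec_pt: "rvec (pt t q) = pt (real_of_int t) (real_of_int q)"
  unfolding pt_def by (intro eq_vecI) auto

lemma pt_eq_iff: "pt t q = pt t' q' \<longleftrightarrow> t = t' \<and> q = q'"
proof
  assume eq: "pt t q = pt t' q'"
  have "pt t q $ 0 = pt t' q' $ 0" "pt t q $ 1 = pt t' q' $ 1" unfolding eq by simp_all
  then show "t = t' \<and> q = q'" by (simp add: pt_def)
qed simp

lemma pt_mem_coupled_P:
  "pt t q \<in> coupled_P a c \<longleftrightarrow> - a \<le> t \<and> t \<le> c \<and> 0 \<le> q \<and> q \<le> 2 \<and> 0 \<le> q + t \<and> q + t \<le> 2"
  unfolding mem_coupled_P ball_1_4 by auto

lemma eq_ptI: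
  assumes "z \<in> carrier_vec 5" and "z $ 0 = t" and "\<And>j. j \<in> {1..4} \<Longrightarrow> z $ j = q"
  shows "z = pt t q"
  using assms by (intro vec5_eqI) auto

lemma pt_in_closed_seg:
  assumes "0 \<le> s" "s \<le> 1" "t = (1 - s) * t0 + s * t1" "q = (1 - s) * q0 + s * q1"
  shows "pt t q \<in> closed_seg (pt t0 q0) (pt t1 q1)"
  unfolding closed_seg_def
  by (rule CollectI, rule exI[of _ s]) (simp add: pt_add pt_smult assms)

lemmas pt_arith = pt_add pt_diff pt_smult pt_uminus rvec_pt pt_eq_iff pt_mem_coupled_P

text \<open>These are the axis directions of the witness walks: all \<open>p\<close> up, all
  \<open>p\<close> down, all \<open>q\<close> up. The unchanged coordinates give forms that vanish
  on no other line.\<close>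

lemma circuit_ptI:
  assumes "(t, q) \<in> {(1, 0), (-1, 0), (-1, 1)}"
  shows "circuit coupled_A coupled_B (pt t q)"
proof (rule circuitI[where m = 18])
  show "coupled_B \<in> carrier_mat 18 (dim_col coupled_A)" using coupled_B_carrier by simp
  show "rvec (pt t q) \<in> mat_kernel (rmat coupled_A)"
    unfolding mat_kernel_def rvec_pt by (auto intro!: eq_vecI)
  show "pt t q \<noteq> 0\<^sub>v (dim_col coupled_A)"
  proof
    assume "pt t q = 0\<^sub>v (dim_col coupled_A)"
    then have "pt t q $ 0 = 0\<^sub>v 5 $ 0" by simp
    then show False using assms by auto
  qed
  have "1 \<in> {1..4::nat}" by simp
  then have "(\<lambda>j. pt t q $ j) ` {1..4} = {q}" by force
  then have "set\<^sub>v (pt t q) = {t, q}" by (simp add: set_vec5)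
  then show "Gcd (set\<^sub>v (pt t q)) = 1" using assms by auto
  fix z assume z: "z \<in> carrier_vec (dim_col coupled_A)"
    and zero: "\<And>i. i < 18 \<Longrightarrow> (rmat coupled_B *\<^sub>v rvec (pt t q)) $ i = 0 \<Longrightarrow> (rmat coupled_B *\<^sub>v z) $ i = 0"
  have zero': "coupled_form i z = 0" if "i < 9" "coupled_form i (rvec (pt t q)) = 0" for i
    using zero[of i] z that by (simp add: coupled_B_mult rvec_pt del: index_mult_mat_vec)
  show "\<exists>c. z = c \<cdot>\<^sub>v rvec (pt t q)"
  proof (cases "q = 0")
    case True
    have "z $ j = 0" if "j \<in> {1..4}" for j
      using zero'[of j] that True by (simp add: coupled_form_def rvec_pt)
    then have "z = pt (z $ 0) 0" using z by (intro eq_ptI) auto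
    then have "z = (z $ 0 * t) \<cdot>\<^sub>v rvec (pt t q)"
      using True assms by (auto simp: rvec_pt pt_smult)
    then show ?thesis ..
  next
    case False
    then have tq: "t = -1" "q = 1" using assms by auto
    have "z $ j = - z $ 0" if "j \<in> {1..4}" for j
      using zero'[of "j + 4"] that tq by (simp add: coupled_form_def rvec_pt)
    then have "z = pt (z $ 0) (- z $ 0)" using z by (intro eq_ptI) auto
    then have "z = (- z $ 0) \<cdot>\<^sub>v rvec (pt t q)"
      using tq by (simp add: rvec_pt pt_smult)
    then show ?thesis ..
  qed
qed

lemma affine_coupled: "affine_fun 5 (\<lambda>z. A * z $ 0 + C * (z $ 1 + z $ 2 + z $ 3 + z $ 4))"
  unfolding affine_fun_def by (auto simp: algebra_simps)

lemma coupled_P_subset: "coupled_P a c \<subseteq> carrier_vec 5"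
  using mem_coupled_P by blast

lemma sum4_le_max:
  fixes m :: real
  assumes "h1 \<le> m" "h2 \<le> m" "h3 \<le> m" "h4 \<le> m"
  shows "h1 + h2 + h3 + h4 \<le> 4 * m"
    and "h1 + h2 + h3 + h4 = 4 * m \<Longrightarrow> h1 = m \<and> h2 = m \<and> h3 = m \<and> h4 = m"
  using assms by auto

text \<open>The objective is a sum of four copies of one planar objective with a common
  \<open>t\<close>, hence the factor 4 on \<open>A\<close> below, so a planar optimum is optimal in
  every copy at once.\<close>

lemma vertex_coupled_P_ptI:
  assumes mem: "- a \<le> t" "t \<le> c" "0 \<le> q" "q \<le> 2" "0 \<le> q + t" "q + t \<le> 2"
    and le: "\<And>t' q'. - a \<le> t' \<Longrightarrow> t' \<le> c \<Longrightarrow> 0 \<le> q' \<Longrightarrow> q' \<le> 2 \<Longrightarrow> 0 \<le> q' + t' \<Longrightarrow> q' + t' \<le> 2 \<Longrightarrow>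
      A * t' + C * q' \<le> A * t + C * q"
    and eq: "\<And>t' q'. - a \<le> t' \<Longrightarrow> t' \<le> c \<Longrightarrow> 0 \<le> q' \<Longrightarrow> q' \<le> 2 \<Longrightarrow> 0 \<le> q' + t' \<Longrightarrow> q' + t' \<le> 2 \<Longrightarrow>
      A * t' + C * q' = A * t + C * q \<Longrightarrow> t' = t \<and> q' = q"
  shows "vertex_of (pt t q) (coupled_P a c)"
proof (rule vertex_ofI[OF coupled_P_subset affine_coupled[of "4 * A" C]])
  show "pt t q \<in> coupled_P a c" using mem by (simp add: pt_mem_coupled_P)
  fix x assume x: "x \<in> coupled_P a c"
  have le': "A * x $ 0 + C * x $ j \<le> A * t + C * q" if "j \<in> {1..4}" for j
    using le[of "x $ 0" "x $ j"] coupled_P_memD[OF x] that by blast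
  have 4: "1 \<in> {1..4::nat}" "2 \<in> {1..4::nat}" "3 \<in> {1..4::nat}" "4 \<in> {1..4::nat}" by auto
  note sums = le'[OF 4(1)] le'[OF 4(2)] le'[OF 4(3)] le'[OF 4(4)]
  have pt: "4 * A * pt t q $ 0 + C * (pt t q $ 1 + pt t q $ 2 + pt t q $ 3 + pt t q $ 4)
    = 4 * (A * t + C * q)" by (simp add: algebra_simps)
  have split: "4 * A * x $ 0 + C * (x $ 1 + x $ 2 + x $ 3 + x $ 4)
    = (A * x $ 0 + C * x $ 1) + (A * x $ 0 + C * x $ 2) + (A * x $ 0 + C * x $ 3) + (A * x $ 0 + C * x $ 4)"
    by (simp add: algebra_simps)
  show "4 * A * x $ 0 + C * (x $ 1 + x $ 2 + x $ 3 + x $ 4)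
    \<le> 4 * A * pt t q $ 0 + C * (pt t q $ 1 + pt t q $ 2 + pt t q $ 3 + pt t q $ 4)"
    unfolding pt split by (rule sum4_le_max(1)[OF sums])
  assume "4 * A * x $ 0 + C * (x $ 1 + x $ 2 + x $ 3 + x $ 4)
    = 4 * A * pt t q $ 0 + C * (pt t q $ 1 + pt t q $ 2 + pt t q $ 3 + pt t q $ 4)"
  then have "\<forall>j\<in>{1..4}. A * x $ 0 + C * x $ j = A * t + C * q"
    unfolding pt split ball_1_4 by (rule sum4_le_max(2)[OF sums])
  then have "x $ 0 = t \<and> x $ j = q" if "j \<in> {1..4}" for j
    using eq[of "x $ 0" "x $ j"] coupled_P_memD[OF x] that by blast
  then show "x = pt t q" using x coupled_P_subset 4(1) by (intro eq_ptI) blast+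
qed

lemma vertex_coupled_P:
  assumes "1 \<le> c" "c \<le> 2"
  shows "vertex_of (pt 0 0) (coupled_P 1 c)" and "vertex_of (pt 0 2) (coupled_P 1 c)"
    and "vertex_of (pt c 0) (coupled_P 1 c)" and "vertex_of (pt (-1) 2) (coupled_P 1 c)"
proof -
  show "vertex_of (pt 0 0) (coupled_P 1 c)"
    by (rule vertex_coupled_P_ptI[where A = "-1" and C = "-2"]) (use assms in auto)
  show "vertex_of (pt 0 2) (coupled_P 1 c)"
    by (rule vertex_coupled_P_ptI[where A = 1 and C = 2]) (use assms in auto)
  show "vertex_of (pt c 0) (coupled_P 1 c)"
    by (rule vertex_coupled_P_ptI[where A = 1 and C = "-1"]) (use assms in auto)
  show "vertex_of (pt (-1) 2) (coupled_P 1 c)"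
    by (rule vertex_coupled_P_ptI[where A = "-1" and C = 1]) (use assms in auto)
qed

lemma adjacent_coupled_P_ptI:
  assumes v: "vertex_of (pt t0 q0) (coupled_P a c)" "vertex_of (pt t1 q1) (coupled_P a c)"
    and "t0 \<noteq> t1" and f: "A * t0 + C * (4 * q0) = A * t1 + C * (4 * q1)"
    and le: "\<And>x. x \<in> coupled_P a c \<Longrightarrow> A * x $ 0 + C * (x $ 1 + x $ 2 + x $ 3 + x $ 4) \<le> A * t1 + C * (4 * q1)"
    and eq: "\<And>x. x \<in> coupled_P a c \<Longrightarrow> A * x $ 0 + C * (x $ 1 + x $ 2 + x $ 3 + x $ 4) = A * t1 + C * (4 * q1) \<Longrightarrow>
      \<exists>s. 0 \<le> s \<and> s \<le> 1 \<and> x $ 0 = (1 - s) * t0 + s * t1 \<and>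
        (\<forall>j\<in>{1..4}. x $ j = (1 - s) * q0 + s * q1)"
  shows "adjacent_vertices (coupled_P a c) (pt t0 q0) (pt t1 q1)"
proof (rule adjacent_verticesI[OF coupled_P_subset affine_coupled[of A C] convex_polyhedron_of[OF polyhedron_data_coupled] v])
  have pt: "A * pt t q $ 0 + C * (pt t q $ 1 + pt t q $ 2 + pt t q $ 3 + pt t q $ 4) = A * t + C * (4 * q)"
    for t q by simp
  show "pt t0 q0 \<noteq> pt t1 q1" using \<open>t0 \<noteq> t1\<close> by (simp add: pt_eq_iff)
  show "A * pt t0 q0 $ 0 + C * (pt t0 q0 $ 1 + pt t0 q0 $ 2 + pt t0 q0 $ 3 + pt t0 q0 $ 4)
    = A * pt t1 q1 $ 0 + C * (pt t1 q1 $ 1 + pt t1 q1 $ 2 + pt t1 q1 $ 3 + pt t1 q1 $ 4)"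
    unfolding pt by (rule f)
  fix x assume x: "x \<in> coupled_P a c"
  show "A * x $ 0 + C * (x $ 1 + x $ 2 + x $ 3 + x $ 4)
    \<le> A * pt t1 q1 $ 0 + C * (pt t1 q1 $ 1 + pt t1 q1 $ 2 + pt t1 q1 $ 3 + pt t1 q1 $ 4)"
    unfolding pt by (rule le[OF x])
  assume "A * x $ 0 + C * (x $ 1 + x $ 2 + x $ 3 + x $ 4)
    = A * pt t1 q1 $ 0 + C * (pt t1 q1 $ 1 + pt t1 q1 $ 2 + pt t1 q1 $ 3 + pt t1 q1 $ 4)"
  then obtain s where s: "0 \<le> s" "s \<le> 1" "x $ 0 = (1 - s) * t0 + s * t1"
    "\<forall>j\<in>{1..4}. x $ j = (1 - s) * q0 + s * q1"
    using eq[OF x] unfolding pt by blast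
  then have "x = pt ((1 - s) * t0 + s * t1) ((1 - s) * q0 + s * q1)"
    using x coupled_P_subset by (intro eq_ptI) auto
  then show "x \<in> closed_seg (pt t0 q0) (pt t1 q1)" using s pt_in_closed_seg by simp
qed

text \<open>In the plane these are the bottom, right and top sides of the polygon. The functionals
  are minus the sum of the \<open>q\<close>, the sum of the \<open>p\<close> (that is,
  \<open>4 * t\<close> plus the \<open>q\<close>), and the sum of the \<open>q\<close>.\<close>

lemma adjacent_coupled_P:
  shows "adjacent_vertices (coupled_P 1 2) (pt 0 0) (pt 2 0)"
    and "adjacent_vertices (coupled_P 1 2) (pt 2 0) (pt 0 2)"
    and "adjacent_vertices (coupled_P 1 2) (pt 0 2) (pt (-1) 2)"
proof -
  note v = vertex_coupled_P[of 2, simplified]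
  show "adjacent_vertices (coupled_P 1 2) (pt 0 0) (pt 2 0)"
  proof (rule adjacent_coupled_P_ptI[OF v(1,3), where A = 0 and C = "-1"])
    fix x assume "x \<in> coupled_P 1 2"
    then show "0 * x $ 0 + - 1 * (x $ 1 + x $ 2 + x $ 3 + x $ 4) \<le> 0 * 2 + - 1 * (4 * 0)"
      "0 * x $ 0 + - 1 * (x $ 1 + x $ 2 + x $ 3 + x $ 4) = 0 * 2 + - 1 * (4 * 0) \<Longrightarrow>
        \<exists>s. 0 \<le> s \<and> s \<le> 1 \<and> x $ 0 = (1 - s) * 0 + s * 2 \<and>
          (\<forall>j\<in>{1..4}. x $ j = (1 - s) * 0 + s * 0)"
      unfolding mem_coupled_P ball_1_4 by (auto intro!: exI[of _ "x $ 0 / 2"])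
  qed simp_all
  show "adjacent_vertices (coupled_P 1 2) (pt 2 0) (pt 0 2)"
  proof (rule adjacent_coupled_P_ptI[OF v(3,2), where A = 4 and C = 1])
    fix x assume "x \<in> coupled_P 1 2"
    then show "4 * x $ 0 + 1 * (x $ 1 + x $ 2 + x $ 3 + x $ 4) \<le> 4 * 0 + 1 * (4 * 2)"
      "4 * x $ 0 + 1 * (x $ 1 + x $ 2 + x $ 3 + x $ 4) = 4 * 0 + 1 * (4 * 2) \<Longrightarrow>
        \<exists>s. 0 \<le> s \<and> s \<le> 1 \<and> x $ 0 = (1 - s) * 2 + s * 0 \<and>
          (\<forall>j\<in>{1..4}. x $ j = (1 - s) * 0 + s * 2)"
      unfolding mem_coupled_P ball_1_4 by (auto intro!: exI[of _ "1 - x $ 0 / 2"])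
  qed simp_all
  show "adjacent_vertices (coupled_P 1 2) (pt 0 2) (pt (-1) 2)"
  proof (rule adjacent_coupled_P_ptI[OF v(2,4), where A = 0 and C = 1])
    fix x assume "x \<in> coupled_P 1 2"
    then show "0 * x $ 0 + 1 * (x $ 1 + x $ 2 + x $ 3 + x $ 4) \<le> 0 * - 1 + 1 * (4 * 2)"
      "0 * x $ 0 + 1 * (x $ 1 + x $ 2 + x $ 3 + x $ 4) = 0 * - 1 + 1 * (4 * 2) \<Longrightarrow>
        \<exists>s. 0 \<le> s \<and> s \<le> 1 \<and> x $ 0 = (1 - s) * 0 + s * - 1 \<and>
          (\<forall>j\<in>{1..4}. x $ j = (1 - s) * 2 + s * 2)"
      unfolding mem_coupled_P ball_1_4 by (auto intro!: exI[of _ "- x $ 0"])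
  qed simp_all
qed

subsection \<open>Short walks in the family\<close>

text \<open>In the plane: right to \<open>(1, 0)\<close>, up to \<open>(1, 2)\<close>, right to
  \<open>(2, 2)\<close>. The first circuit is used twice.\<close>

lemma CD_fmb_symmetric_le:
  "CD {Feasible, Maximal, NonBackwards} coupled_A coupled_B no_rhs (coupled_d 1 1) (pt 0 0) (pt 0 2) \<le> enat 3"
proof (rule CD_le)
  let ?y = "\<lambda>i. [pt 0 0, pt 1 0, pt (-1) 2, pt 0 2] ! i"
  let ?g = "\<lambda>i. [pt 1 0, pt (-1) 1, pt 1 0] ! i"
  let ?\<alpha> = "\<lambda>i. [1, 2, 1] ! i"
  show "circuit_walk coupled_A coupled_B (pt 0 0) (pt 0 2) 3 ?y ?g ?\<alpha>"
    unfolding circuit_walk_def All_less_3 All_le_3 by (simp add: pt_arith circuit_ptI)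
  fix p assume "p \<in> {Feasible, Maximal, NonBackwards}"
  then show "has_property p coupled_A coupled_B no_rhs (coupled_d 1 1) (pt 0 0) (pt 0 2) 3 ?y ?g ?\<alpha>"
    by (elim insertE emptyE; simp add: All_less_3 All_le_3 pt_arith)
qed

text \<open>The turning point \<open>(2, 0)\<close> has \<open>t = 2\<close> and lies outside the
  polyhedron, which saves one step.\<close>

lemma CD_symmetric_le:
  "CD {} coupled_A coupled_B no_rhs (coupled_d 1 1) (pt 0 0) (pt 0 2) \<le> enat 2"
proof (rule CD_le)
  let ?y = "\<lambda>i. [pt 0 0, pt 2 0, pt 0 2] ! i"
  let ?g = "\<lambda>i. [pt 1 0, pt (-1) 1] ! i"
  let ?\<alpha> = "\<lambda>i. [2, 2] ! i"
  show "circuit_walk coupled_A coupled_B (pt 0 0) (pt 0 2) 2 ?y ?g ?\<alpha>"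
    unfolding circuit_walk_def All_less_2 All_le_2 by (simp add: pt_arith circuit_ptI)
qed simp

text \<open>The single step is the vertical chord from \<open>(1, 0)\<close> to
  \<open>(1, 2)\<close>.\<close>

lemma CD_fmbr_diagonal_le:
  "CD {Feasible, Maximal, NonBackwards, NonRepetitive} coupled_A coupled_B no_rhs (coupled_d 1 1) (pt 1 0) (pt (-1) 2) \<le> enat 1"
proof (rule CD_le)
  let ?y = "\<lambda>i. [pt 1 0, pt (-1) 2] ! i"
  let ?g = "\<lambda>i::nat. pt (-1) 1 :: int vec"
  let ?\<alpha> = "\<lambda>i::nat. 2 :: real"
  have le1: "(\<forall>i\<le>Suc 0. Q i) \<longleftrightarrow> Q 0 \<and> Q 1" for Q by (auto simp: le_Suc_eq)
  show "circuit_walk coupled_A coupled_B (pt 1 0) (pt (-1) 2) 1 ?y ?g ?\<alpha>"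
    unfolding circuit_walk_def by (simp add: le1 pt_arith circuit_ptI)
  fix p assume "p \<in> {Feasible, Maximal, NonBackwards, NonRepetitive}"
  then show "has_property p coupled_A coupled_B no_rhs (coupled_d 1 1) (pt 1 0) (pt (-1) 2) 1 ?y ?g ?\<alpha>"
    by (elim insertE emptyE; simp add: le1 pt_arith)
qed

text \<open>Along the boundary: \<open>(0, 0)\<close>, \<open>(2, 0)\<close>, \<open>(2, 2)\<close>,
  \<open>(1, 2)\<close>. The last circuit is the negative of the first.\<close>

lemma CD_efm_skew_le:
  "CD {Edge, Feasible, Maximal} coupled_A coupled_B no_rhs (coupled_d 1 2) (pt 0 0) (pt (-1) 2) \<le> enat 3"
proof (rule CD_le)
  let ?y = "\<lambda>i. [pt 0 0, pt 2 0, pt 0 2, pt (-1) 2] ! i"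
  let ?g = "\<lambda>i. [pt 1 0, pt (-1) 1, pt (-1) 0] ! i"
  let ?\<alpha> = "\<lambda>i. [2, 2, 1] ! i"
  show "circuit_walk coupled_A coupled_B (pt 0 0) (pt (-1) 2) 3 ?y ?g ?\<alpha>"
    unfolding circuit_walk_def All_less_3 All_le_3 by (simp add: pt_arith circuit_ptI)
  fix p assume "p \<in> {Edge, Feasible, Maximal}"
  then show "has_property p coupled_A coupled_B no_rhs (coupled_d 1 2) (pt 0 0) (pt (-1) 2) 3 ?y ?g ?\<alpha>"
    by (elim insertE emptyE; simp add: All_less_3 All_le_3 pt_arith adjacent_coupled_P)
qed

text \<open>The walk turns at \<open>(1, 0)\<close>, before its first step is maximal.\<close>

lemma CD_fbr_skew_le:
  "CD {Feasible, NonBackwards, NonRepetitive} coupled_A coupled_B no_rhs (coupled_d 1 2) (pt 0 0) (pt (-1) 2) \<le> enat 2"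
proof (rule CD_le)
  let ?y = "\<lambda>i. [pt 0 0, pt 1 0, pt (-1) 2] ! i"
  let ?g = "\<lambda>i. [pt 1 0, pt (-1) 1] ! i"
  let ?\<alpha> = "\<lambda>i. [1, 2] ! i"
  show "circuit_walk coupled_A coupled_B (pt 0 0) (pt (-1) 2) 2 ?y ?g ?\<alpha>"
    unfolding circuit_walk_def All_less_2 All_le_2 by (simp add: pt_arith circuit_ptI)
  fix p assume "p \<in> {Feasible, NonBackwards, NonRepetitive}"
  then show "has_property p coupled_A coupled_B no_rhs (coupled_d 1 2) (pt 0 0) (pt (-1) 2) 2 ?y ?g ?\<alpha>"
    by (elim insertE emptyE; simp add: All_less_2 All_le_2 pt_arith)
qed

subsection \<open>Lower bounds in the family\<close>

lemma coupled_walk_coord: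
  assumes "circuit_walk coupled_A coupled_B v1 v2 k y g \<alpha>" and "i < k" and "j < 5"
  shows "y (Suc i) $ j = y i $ j + \<alpha> i * real_of_int (g i $ j)"
proof -
  have "circuit coupled_A coupled_B (g i)" "y i \<in> carrier_vec 5" using assms(1,2) unfolding circuit_walk_def by auto
  then have "g i \<in> carrier_vec 5" "y i \<in> carrier_vec 5" using circuit_carrier by force+
  then show ?thesis unfolding circuit_walk_Suc[OF assms(1,2)] using assms(3) by simp
qed

text \<open>Shorter walks are padded with zero moves, so that all walks of at most three steps have three moves.\<close>

definition move :: "nat \<Rightarrow> (nat \<Rightarrow> int vec) \<Rightarrow> (nat \<Rightarrow> real) \<Rightarrow> nat \<Rightarrow> nat \<Rightarrow> real" where
  "move k g \<alpha> j i = (if i < k then \<alpha> i * real_of_int (g i $ j) else 0)"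

lemma coupled_walk_moves:
  assumes "circuit_walk coupled_A coupled_B v1 v2 k y g \<alpha>" and "k \<le> 3" and "j < 5"
  shows "y (min 1 k) $ j = v1 $ j + move k g \<alpha> j 0"
    and "y (min 2 k) $ j = v1 $ j + move k g \<alpha> j 0 + move k g \<alpha> j 1"
    and "v2 $ j = v1 $ j + move k g \<alpha> j 0 + move k g \<alpha> j 1 + move k g \<alpha> j 2"
proof -
  have step: "y (min (Suc m) k) $ j = y (min m k) $ j + move k g \<alpha> j m" for m
    using coupled_walk_coord[OF assms(1) _ assms(3), of m] unfolding move_def
    by (cases "m < k") (auto simp: min_def not_less)
  have v: "y 0 = v1" "y k = v2" using assms(1) unfolding circuit_walk_def by auto
  show 1: "y (min 1 k) $ j = v1 $ j + move k g \<alpha> j 0" using step[of 0] v by simp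
  then show 2: "y (min 2 k) $ j = v1 $ j + move k g \<alpha> j 0 + move k g \<alpha> j 1"
    using step[of 1] by (simp add: numeral_2_eq_2)
  have "min 3 k = k" using assms(2) by simp
  then show "v2 $ j = v1 $ j + move k g \<alpha> j 0 + move k g \<alpha> j 1 + move k g \<alpha> j 2"
    using step[of 2] 2 v by (simp add: numeral_3_eq_3)
qed

lemma coupled_walk_move_global:
  assumes "circuit_walk coupled_A coupled_B v1 v2 k y g \<alpha>" and "\<And>i. i < k \<Longrightarrow> g i $ 0 \<noteq> 0" and "j \<in> {1..4}"
  shows "move k g \<alpha> j i = 0 \<or> move k g \<alpha> j i = - move k g \<alpha> 0 i"
proof (cases "i < k")
  case True
  then have "circuit coupled_A coupled_B (g i)" using assms(1) unfolding circuit_walk_def by simp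
  then have "g i $ j = 0 \<or> g i $ j = - g i $ 0"
  proof (cases rule: coupled_circuit_cases)
    case single
    then show ?thesis using assms(2)[OF True] by simp
  next
    case global
    then show ?thesis using assms(3) by blast
  qed
  then show ?thesis unfolding move_def by auto
qed (simp add: move_def)

text \<open>Three single-copy steps cannot reach all four copies, so some copy only sees the global circuits.\<close>

lemma coupled_walk_untouched_copy:
  assumes walk: "circuit_walk coupled_A coupled_B v1 v2 k y g \<alpha>" and k: "k \<le> 3"
  obtains j where "j \<in> {1..4}" "\<And>i. i < k \<Longrightarrow> g i $ 0 = 0 \<Longrightarrow> g i $ j = 0"
    "\<And>i. move k g \<alpha> j i = 0 \<or> move k g \<alpha> j i = - move k g \<alpha> 0 i"
proof -
  have circ: "circuit coupled_A coupled_B (g i)" if "i < k" for i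
    using walk that unfolding circuit_walk_def by simp
  \<comment> \<open>A single-copy step breaks the alternative only in its own copy and a global step
    nowhere, so each step rules out at most one copy.\<close>
  have "\<exists>l. \<forall>j\<in>{1..4}. j \<noteq> l \<longrightarrow> g i $ j = 0 \<or> g i $ 0 \<noteq> 0 \<and> g i $ j = - g i $ 0" if "i < k" for i
    using circ[OF that]
  proof (cases rule: coupled_circuit_cases)
    case global
    then have "g i $ 0 \<noteq> 0" by auto
    then show ?thesis using global(2) by blast
  qed blast
  then obtain l where l: "\<And>i j. i < k \<Longrightarrow> j \<in> {1..4} \<Longrightarrow> j \<noteq> l i \<Longrightarrow>
    g i $ j = 0 \<or> g i $ 0 \<noteq> 0 \<and> g i $ j = - g i $ 0"
    by (metis (no_types))
  have "card (l ` {..<k}) < card {1..4::nat}"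
    using k card_image_le[of "{..<k}" l] by simp
  then have "\<not> {1..4} \<subseteq> l ` {..<k}" by (meson card_mono finite_imageI finite_lessThan not_less)
  then obtain j where j: "j \<in> {1..4}" "j \<notin> l ` {..<k}" by blast
  show ?thesis
  proof (rule that[OF j(1)])
    show "g i $ j = 0" if "i < k" "g i $ 0 = 0" for i
      using l[OF that(1) j(1)] j(2) that by blast
    show "move k g \<alpha> j i = 0 \<or> move k g \<alpha> j i = - move k g \<alpha> 0 i" for i
    proof (cases "i < k")
      case True
      then have "g i $ j = 0 \<or> g i $ j = - g i $ 0" using l[of i j] j by blast
      then show ?thesis using True unfolding move_def by auto
    qed (simp add: move_def)
  qed
qed

text \<open>Here \<open>a\<close> and \<open>c\<close> are the changes of \<open>t\<close> and of
  one \<open>q\<close>. The steps with \<open>c = - a\<close> lower \<open>t\<close> by 2 in total,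
  the remaining steps raise it by 2. The first and the last step change \<open>t\<close> by at most
  1 each, so whichever group omits the middle step consists of both of them, each with change of
  size exactly 1.\<close>

lemma symmetric_arith:
  fixes a0 a1 a2 c0 c1 c2 :: real
  assumes "a0 + a1 + a2 = 0" "c0 + c1 + c2 = 2" "-1 \<le> a0" "a0 \<le> 1" "-1 \<le> a0 + a1" "a0 + a1 \<le> 1"
    and "c0 = 0 \<or> c0 = - a0" "c1 = 0 \<or> c1 = - a1" "c2 = 0 \<or> c2 = - a2"
  shows "a0 \<noteq> 0" "a1 \<noteq> 0" "a2 \<noteq> 0" "a0 = a2" "c0 = c2"
  using assms by (elim disjE; linarith)+

lemma symmetric_short_walk:
  assumes walk: "circuit_walk coupled_A coupled_B (pt 0 0) (pt 0 2) k y g \<alpha>"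
    and feas: "has_property Feasible coupled_A coupled_B no_rhs (coupled_d 1 1) (pt 0 0) (pt 0 2) k y g \<alpha>"
    and k: "k \<le> 3"
  shows "k = 3 \<and> g 0 = g 2"
proof -
  note m0 = coupled_walk_moves[OF walk k, of 0, simplified]
  have bound: "-1 \<le> y (min m k) $ 0" "y (min m k) $ 0 \<le> 1" for m
    using feas coupled_P_memD(1,2)[of "y (min m k)" 1 1] by auto
  have arith: "move k g \<alpha> 0 0 \<noteq> 0 \<and> move k g \<alpha> 0 1 \<noteq> 0 \<and> move k g \<alpha> 0 2 \<noteq> 0 \<and>
      move k g \<alpha> 0 0 = move k g \<alpha> 0 2 \<and> move k g \<alpha> j 0 = move k g \<alpha> j 2"
    if j: "j \<in> {1..4}" and c: "\<And>i. move k g \<alpha> j i = 0 \<or> move k g \<alpha> j i = - move k g \<alpha> 0 i" for j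
  proof -
    have "j < 5" using j by simp
    then have "move k g \<alpha> j 0 + move k g \<alpha> j 1 + move k g \<alpha> j 2 = 2"
      using coupled_walk_moves(3)[OF walk k, of j] j by simp
    moreover have "move k g \<alpha> 0 0 + move k g \<alpha> 0 1 + move k g \<alpha> 0 2 = 0"
      "-1 \<le> move k g \<alpha> 0 0" "move k g \<alpha> 0 0 \<le> 1"
      "-1 \<le> move k g \<alpha> 0 0 + move k g \<alpha> 0 1" "move k g \<alpha> 0 0 + move k g \<alpha> 0 1 \<le> 1"
      using m0 bound[of 1] bound[of 2] by simp_all
    ultimately show ?thesis
      using symmetric_arith[OF _ _ _ _ _ _ c[of 0] c[of 1] c[of 2]] by blast
  qed
  obtain j where j: "j \<in> {1..4}"
    and "\<And>i. move k g \<alpha> j i = 0 \<or> move k g \<alpha> j i = - move k g \<alpha> 0 i"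
    using coupled_walk_untouched_copy[OF walk k] by metis
  from arith[OF this] have nz: "move k g \<alpha> 0 0 \<noteq> 0" "move k g \<alpha> 0 1 \<noteq> 0" "move k g \<alpha> 0 2 \<noteq> 0"
    and eq0: "move k g \<alpha> 0 0 = move k g \<alpha> 0 2" by auto
  \<comment> \<open>Padding moves are zero, so three nonzero moves are three genuine steps.\<close>
  then have k3: "k = 3" using k unfolding move_def by (auto split: if_splits)
  have g0: "g i $ 0 \<noteq> 0" if "i < k" for i
  proof -
    have "i = 0 \<or> i = 1 \<or> i = 2" using that k3 by auto
    then show ?thesis using nz unfolding move_def by (auto split: if_splits)
  qed
  have abs: "\<bar>g i $ 0\<bar> = 1" if "i < k" for i
  proof -
    have "circuit coupled_A coupled_B (g i)" using walk that unfolding circuit_walk_def by simp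
    then show ?thesis by (cases rule: coupled_circuit_cases) (use g0[OF that] in auto)
  qed
  have pos: "0 < \<alpha> 0" "0 < \<alpha> 2" and circ: "circuit coupled_A coupled_B (g 0)" "circuit coupled_A coupled_B (g 2)"
    using walk k3 unfolding circuit_walk_def by auto
  have mv: "\<alpha> 0 * real_of_int (g 0 $ 0) = \<alpha> 2 * real_of_int (g 2 $ 0)"
    using eq0 k3 unfolding move_def by simp
  have "g 0 $ 0 = 1 \<or> g 0 $ 0 = -1" "g 2 $ 0 = 1 \<or> g 2 $ 0 = -1"
    using abs[of 0] abs[of 2] k3 by auto
  then have same: "g 0 $ 0 = g 2 $ 0" "\<alpha> 0 = \<alpha> 2" using mv pos by auto
  \<comment> \<open>Now that all steps are known to be global, the arithmetic of the untouched copy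
    applies to every copy.\<close>
  have "g 0 $ j = g 2 $ j" if j: "j \<in> {1..4}" for j
  proof -
    have "move k g \<alpha> j 0 = move k g \<alpha> j 2"
      using arith[OF j coupled_walk_move_global[OF walk g0 j]] by simp
    then show ?thesis using same pos k3 unfolding move_def by simp
  qed
  then have "g 0 = g 2" using circ[THEN circuit_carrier] same by (intro vec5_eqI) auto
  then show ?thesis using k3 by simp
qed

text \<open>The centre \<open>pt 0 1\<close> of the segment is also the midpoint of
  \<open>pt 0 0\<close> and \<open>pt 0 2\<close>, which a face would have to contain as
  well.\<close>

lemma diagonal_not_adjacent: "\<not> adjacent_vertices (coupled_P 1 1) (pt 1 0) (pt (-1) 2)"
proof
  assume "adjacent_vertices (coupled_P 1 1) (pt 1 0) (pt (-1) 2)"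
  then have face: "vec_face_of (closed_seg (pt 1 0) (pt (-1) 2)) (coupled_P 1 1)"
    unfolding adjacent_vertices_def by simp
  have "pt 0 1 \<in> closed_seg (pt 0 0) (pt 0 (2::real))"
    by (rule pt_in_closed_seg[of "1/2"]) auto
  then have "pt 0 1 \<in> open_seg (pt 0 0) (pt 0 2)"
    unfolding open_seg_def by (simp add: pt_eq_iff)
  moreover have "pt 0 1 \<in> closed_seg (pt 1 0) (pt (-1) (2::real))"
    by (rule pt_in_closed_seg[of "1/2"]) auto
  moreover have "pt 0 0 \<in> coupled_P 1 1" "pt 0 2 \<in> coupled_P 1 1" by (simp_all add: pt_mem_coupled_P)
  ultimately have "pt 0 0 \<in> closed_seg (pt 1 0) (pt (-1) (2::real))"
    using face unfolding vec_face_of_def by blast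
  then show False unfolding closed_seg_def by (auto simp: pt_arith)
qed

lemma diagonal_edge_walk_ge:
  assumes "circuit_walk coupled_A coupled_B (pt 1 0) (pt (-1) 2) k y g \<alpha>"
    and "has_property Edge coupled_A coupled_B no_rhs (coupled_d 1 1) (pt 1 0) (pt (-1) 2) k y g \<alpha>"
  shows "2 \<le> k"
proof (rule ccontr)
  assume "\<not> 2 \<le> k"
  then have "k = 0 \<or> k = 1" by auto
  then show False
    using assms diagonal_not_adjacent unfolding circuit_walk_def by (auto simp: pt_eq_iff)
qed

text \<open>Row 0 forces \<open>t\<close> never to increase. In the untouched copy
  \<open>p = q + t\<close> then never increases either, although it has to get from 0 to 1.\<close>

lemma skew_sign_compatible_walk_ge:
  assumes walk: "circuit_walk coupled_A coupled_B (pt 0 0) (pt (-1) 2) k y g \<alpha>"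
    and sign: "has_property SignCompatible coupled_A coupled_B no_rhs (coupled_d 1 2) (pt 0 0) (pt (-1) 2) k y g \<alpha>"
  shows "4 \<le> k"
proof (rule ccontr)
  assume "\<not> 4 \<le> k"
  then have k: "k \<le> 3" by simp
  obtain j where j: "j \<in> {1..4}" and un: "\<And>i. i < k \<Longrightarrow> g i $ 0 = 0 \<Longrightarrow> g i $ j = 0"
    and mv: "\<And>i. move k g \<alpha> j i = 0 \<or> move k g \<alpha> j i = - move k g \<alpha> 0 i"
    using coupled_walk_untouched_copy[OF walk k] by metis
  have "move k g \<alpha> j i + move k g \<alpha> 0 i \<le> 0" for i
  proof (cases "i < k")
    case True
    have circ: "circuit coupled_A coupled_B (g i)" and pos: "0 < \<alpha> i"
      using walk True unfolding circuit_walk_def by auto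
    have gc: "rvec (g i) \<in> carrier_vec 5" using circuit_carrier[OF circ] by simp
    have "0 \<le> (rmat coupled_B *\<^sub>v rvec (g i)) $ 0 * (rmat coupled_B *\<^sub>v (pt (-1) 2 - pt 0 0)) $ 0"
      using sign True coupled_B_carrier unfolding has_property.simps by auto
    then have "g i $ 0 \<le> 0"
      using gc by (simp add: coupled_B_mult coupled_form_def pt_arith del: index_mult_mat_vec)
    then have "move k g \<alpha> 0 i \<le> 0"
      using pos True unfolding move_def by (simp add: mult_nonneg_nonpos)
    moreover have "move k g \<alpha> j i = 0 \<or> move k g \<alpha> j i = - move k g \<alpha> 0 i" by (rule mv)
    ultimately show ?thesis by auto
  qed (simp add: move_def)
  from this[of 0] this[of 1] this[of 2] show False
    using coupled_walk_moves(3)[OF walk k, of 0] coupled_walk_moves(3)[OF walk k, of j] j by simp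
qed

text \<open>The cases are the maximal first steps as seen by the untouched copy: it stays at
  \<open>(0, 0)\<close>, moves to \<open>(2, 0)\<close>, or moves to \<open>(0, 1)\<close>. The
  lower bound on \<open>t\<close> after two steps excludes most ways to distribute the rest.\<close>

lemma skew_arith:
  fixes a0 a1 a2 c0 c1 c2 :: real
  assumes "a0 + a1 + a2 = -1" "c0 + c1 + c2 = 2" "-1 \<le> a0 + a1"
    and "c1 = 0 \<or> c1 = - a1" "c2 = 0 \<or> c2 = - a2"
  shows "a0 = 0 \<Longrightarrow> c0 = 0 \<Longrightarrow> a1 = 1 \<and> a2 = -2"
    and "a0 = 2 \<Longrightarrow> c0 = 0 \<Longrightarrow> a1 = -1 \<and> a2 = -2 \<and> c1 = 0 \<or> a1 = -2 \<and> a2 = -1 \<and> c2 = 0"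
    and "a0 = -1 \<Longrightarrow> c0 = 1 \<Longrightarrow> a1 = 1 \<and> a2 = -1 \<and> c1 = 0"
  using assms by auto

text \<open>The first circuit decides. After a single-copy step, or after the step to
  \<open>(0, 1)\<close>, the second step would need length 1 although length 2 is feasible. Only the
  step to \<open>(2, 0)\<close> survives, and the later step that changes \<open>t\<close> by -1
  reverses its direction.\<close>

lemma skew_short_walk:
  assumes walk: "circuit_walk coupled_A coupled_B (pt 0 0) (pt (-1) 2) k y g \<alpha>"
    and feas: "has_property Feasible coupled_A coupled_B no_rhs (coupled_d 1 2) (pt 0 0) (pt (-1) 2) k y g \<alpha>"
    and maxi: "has_property Maximal coupled_A coupled_B no_rhs (coupled_d 1 2) (pt 0 0) (pt (-1) 2) k y g \<alpha>"
    and k: "k \<le> 3"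
  shows "k = 3 \<and> (g 1 = - g 0 \<or> g 2 = - g 0)"
proof -
  have circ: "circuit coupled_A coupled_B (g i)" and pos: "0 < \<alpha> i" if "i < k" for i
    using walk that unfolding circuit_walk_def by auto
  have gc: "g i \<in> carrier_vec 5" if "i < k" for i using circuit_carrier[OF circ[OF that]] by simp
  have y0: "y 0 = pt 0 0" using walk unfolding circuit_walk_def by simp
  have P: "y i \<in> coupled_P 1 2" if "i \<le> k" for i using feas that by simp
  have step: "y (Suc i) $ j = y i $ j + \<alpha> i * g i $ j" if "i < k" "j < 5" for i j
    using coupled_walk_coord[OF walk that] .
  \<comment> \<open>Maximality enters as a lower bound on step lengths: no feasible length exceeds
    the chosen one.\<close>
  have bound: "\<beta> \<le> \<alpha> i" if i: "i < k" and t: "-1 \<le> y i $ 0 + \<beta> * g i $ 0" "y i $ 0 + \<beta> * g i $ 0 \<le> 2"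
    and q: "\<And>j. j \<in> {1..4} \<Longrightarrow> 0 \<le> y i $ j + \<beta> * g i $ j \<and> y i $ j + \<beta> * g i $ j \<le> 2 \<and>
      0 \<le> y i $ j + \<beta> * g i $ j + (y i $ 0 + \<beta> * g i $ 0) \<and>
      y i $ j + \<beta> * g i $ j + (y i $ 0 + \<beta> * g i $ 0) \<le> 2" for i and \<beta> :: real
  proof (rule ccontr)
    assume "\<not> \<beta> \<le> \<alpha> i"
    then have "y i + \<beta> \<cdot>\<^sub>v rvec (g i) \<notin> coupled_P 1 2" using maxi i by simp
    moreover have "y i \<in> carrier_vec 5" "rvec (g i) \<in> carrier_vec 5"
      using P[of i] gc[OF i] i coupled_P_subset by auto
    moreover have "(y i + \<beta> \<cdot>\<^sub>v rvec (g i)) $ j = y i $ j + \<beta> * g i $ j" if "j < 5" for j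
      using gc[OF i] that by simp
    ultimately show False using t q unfolding mem_coupled_P by auto
  qed
  have coord: "0 \<le> y i $ j" "y i $ j \<le> 2" "0 \<le> y i $ j + y i $ 0" "y i $ j + y i $ 0 \<le> 2"
    if "i \<le> k" "j \<in> {1..4}" for i j
    using coupled_P_memD(3)[OF P[OF that(1)] that(2)] by auto
  have tb: "-1 \<le> y i $ 0" "y i $ 0 \<le> 2" if "i \<le> k" for i
    using coupled_P_memD(1,2)[OF P[OF that]] by auto
  let ?a = "move k g \<alpha> 0"
  have a: "?a 0 + ?a 1 + ?a 2 = -1" "-1 \<le> ?a 0 + ?a 1"
    using coupled_walk_moves[OF walk k, of 0] tb(1)[of "min 2 k"] by simp_all
  have c: "move k g \<alpha> j 0 + move k g \<alpha> j 1 + move k g \<alpha> j 2 = 2" if "j \<in> {1..4}" for j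
    using coupled_walk_moves(3)[OF walk k, of j] that by simp
  have unit: "g i $ 0 = s \<and> \<alpha> i = 1" if "i < k" "?a i = real_of_int s" "s = 1 \<or> s = -1" for i s
  proof -
    have e: "\<alpha> i * g i $ 0 = real_of_int s" using that unfolding move_def by simp
    show ?thesis using circ[OF that(1)]
    proof (cases rule: coupled_circuit_cases)
      case single
      then show ?thesis using e that(3) by auto
    next
      case global
      then have "g i $ 0 = 1 \<or> g i $ 0 = -1" by auto
      then show ?thesis using e that(3) pos[OF that(1)] by auto
    qed
  qed
  obtain j where j: "j \<in> {1..4}" and un: "\<And>i. i < k \<Longrightarrow> g i $ 0 = 0 \<Longrightarrow> g i $ j = 0"
    and cj: "\<And>i. move k g \<alpha> j i = 0 \<or> move k g \<alpha> j i = - ?a i"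
    using coupled_walk_untouched_copy[OF walk k] by metis
  note arith = skew_arith[OF a(1) c a(2)]
  have k0: "0 < k"
  proof (rule ccontr)
    assume "\<not> 0 < k"
    then show False using c[OF j] unfolding move_def by simp
  qed
  have y1: "y 1 $ l = \<alpha> 0 * g 0 $ l" if "l = 0 \<or> l \<in> {1..4}" for l
    using step[OF k0, of l] y0 that by auto
  have all_global: "g i $ 0 \<noteq> 0" if "i < k" "?a 0 \<noteq> 0" "?a 1 \<noteq> 0" "?a 2 \<noteq> 0" for i
  proof -
    have "i = 0 \<or> i = 1 \<or> i = 2" using that(1) k by auto
    then show ?thesis using that unfolding move_def by auto
  qed
  show ?thesis using circ[OF k0]
  proof (cases rule: coupled_circuit_cases)
    case (single i)
    have "?a 0 = 0" "move k g \<alpha> j 0 = 0" using single(2) un[OF k0] unfolding move_def by auto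
    then have a12: "?a 1 = 1" "?a 2 = -2" using arith(1)[OF j cj cj] by auto
    then have k3: "k = 3" using k unfolding move_def by (auto split: if_splits)
    have g1: "g 1 $ 0 = 1" "\<alpha> 1 = 1" using unit[of 1 1] a12 k3 by auto
    have "0 \<le> \<alpha> 0 * g 0 $ i" using coord(1)[of 1 i] y1[of i] single(1) k3 by simp
    then have gi: "g 0 $ i = 1" using single(3) pos[OF k0] by (simp add: zero_le_mult_iff)
    have "2 \<le> \<alpha> 0"
    proof (rule bound[OF k0])
      fix l :: nat assume "l \<in> {1..4}"
      then show "0 \<le> y 0 $ l + 2 * real_of_int (g 0 $ l) \<and> y 0 $ l + 2 * real_of_int (g 0 $ l) \<le> 2 \<and>
        0 \<le> y 0 $ l + 2 * real_of_int (g 0 $ l) + (y 0 $ 0 + 2 * real_of_int (g 0 $ 0)) \<and>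
        y 0 $ l + 2 * real_of_int (g 0 $ l) + (y 0 $ 0 + 2 * real_of_int (g 0 $ 0)) \<le> 2"
        using single gi y0 by (cases "l = i") auto
    qed (simp_all add: y0 single)
    moreover have "\<alpha> 0 \<le> 2" using coord(2)[of 1 i] y1[of i] single(1) gi k3 by simp
    ultimately have "\<alpha> 0 = 2" by simp
    then have y1': "y 1 $ 0 = 0" "y 1 $ i = 2" "\<And>l. l \<in> {1..4} \<Longrightarrow> l \<noteq> i \<Longrightarrow> y 1 $ l = 0"
      using y1 single gi by auto
    have g1l: "g 1 $ l = 0 \<or> g 1 $ l = -1" if "l \<in> {1..4}" for l
    proof -
      have "circuit coupled_A coupled_B (g 1)" using circ[of 1] k3 by simp
      then show ?thesis
      proof (cases rule: coupled_circuit_cases)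
        case single
        then show ?thesis using g1 by simp
      next
        case global
        then show ?thesis using g1 that by simp
      qed
    qed
    have y2: "y 2 $ l = y 1 $ l + g 1 $ l" if "l < 5" for l
      using step[of 1 l] that k3 g1 by (simp add: numeral_2_eq_2)
    \<comment> \<open>While \<open>t\<close> rises, copies at \<open>(0, 0)\<close> cannot lower
      \<open>q\<close>, and copy \<open>i\<close> at \<open>(2, 2)\<close> cannot raise
      \<open>p\<close>. This determines \<open>g 1\<close>, and along it length 2 is still
      feasible.\<close>
    have g1': "g 1 $ l = 0" if "l \<in> {1..4}" "l \<noteq> i" for l
      using coord(1)[of 2 l] y2[of l] y1'(3)[OF that] g1l[OF that(1)] that k3 by auto
    have g1i: "g 1 $ i = -1"
      using coord(4)[of 2 i] y2[of i] y2[of 0] y1' g1l[OF single(1)] single(1) g1 k3 by auto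
    have "2 \<le> \<alpha> 1"
    proof (rule bound)
      fix l :: nat assume "l \<in> {1..4}"
      then show "0 \<le> y 1 $ l + 2 * real_of_int (g 1 $ l) \<and> y 1 $ l + 2 * real_of_int (g 1 $ l) \<le> 2 \<and>
        0 \<le> y 1 $ l + 2 * real_of_int (g 1 $ l) + (y 1 $ 0 + 2 * real_of_int (g 1 $ 0)) \<and>
        y 1 $ l + 2 * real_of_int (g 1 $ l) + (y 1 $ 0 + 2 * real_of_int (g 1 $ 0)) \<le> 2"
        using g1 g1' g1i y1' by (cases "l = i") auto
    qed (use g1 y1' k3 in simp_all)
    then show ?thesis using g1 by simp
  next
    case global
    then consider "g 0 $ 0 = 1" | "g 0 $ 0 = -1" by linarith
    then show ?thesis
    proof cases
      case 1
      have g0: "g 0 $ l = 0" if l: "l \<in> {1..4}" for l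
      proof -
        have "0 \<le> \<alpha> 0 * g 0 $ l" using coord(1)[of 1 l] y1[of l] k0 l by simp
        then show ?thesis using global(2)[OF l] 1 pos[OF k0] by (auto simp: zero_le_mult_iff)
      qed
      have "2 \<le> \<alpha> 0" by (rule bound[OF k0]) (use y0 1 g0 in auto)
      moreover have "\<alpha> 0 \<le> 2" using tb(2)[of 1] y1[of 0] 1 k0 by simp
      ultimately have a0: "?a 0 = 2" "\<And>l. l \<in> {1..4} \<Longrightarrow> move k g \<alpha> l 0 = 0"
        using 1 g0 k0 unfolding move_def by auto
      note ar = arith(2)[OF _ _ _ a0(1)]
      have a12: "?a 1 = -1 \<and> ?a 2 = -2 \<or> ?a 1 = -2 \<and> ?a 2 = -1"
        using ar[OF j cj cj a0(2)[OF j]] by auto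
      then have k3: "k = 3" using k unfolding move_def by (auto split: if_splits)
      have nz: "g i $ 0 \<noteq> 0" if "i < k" for i using all_global[OF that] a0(1) a12 by auto
      \<comment> \<open>Which alternative holds is visible from \<open>t\<close> alone, so it is the
        same in all copies.\<close>
      have all: "?a 1 = -1 \<and> move k g \<alpha> l 1 = 0 \<or> ?a 1 = -2 \<and> move k g \<alpha> l 2 = 0" if l: "l \<in> {1..4}" for l
        using ar[OF l coupled_walk_move_global[OF walk nz l] coupled_walk_move_global[OF walk nz l] a0(2)[OF l]] by auto
      have neg: "g i = - g 0"
        if i: "i < k" and ai: "?a i = -1" and ci: "\<And>l. l \<in> {1..4} \<Longrightarrow> move k g \<alpha> l i = 0" for i
      proof (rule vec5_eqI)
        have gi: "g i $ 0 = -1" using unit[OF i, of "-1"] ai by simp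
        then show "g i $ 0 = (- g 0) $ 0" using 1 gc[OF k0] by simp
        fix l :: nat assume l: "l \<in> {1..4}"
        then show "g i $ l = (- g 0) $ l"
          using ci[OF l] g0[OF l] i pos[OF i] gc[OF k0] unfolding move_def by auto
      qed (use gc i k0 in auto)
      from a12 show ?thesis
      proof
        assume "?a 1 = -1 \<and> ?a 2 = -2"
        then show ?thesis using neg[of 1] all k3 by auto
      next
        assume "?a 1 = -2 \<and> ?a 2 = -1"
        then show ?thesis using neg[of 2] all k3 by auto
      qed
    next
      case 2
      have g0: "g 0 $ l = 1" if l: "l \<in> {1..4}" for l
      proof -
        have "0 \<le> \<alpha> 0 * g 0 $ l + \<alpha> 0 * g 0 $ 0"
          using coord(3)[of 1 l] y1[of l] y1[of 0] k0 l by simp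
        then show ?thesis using global(2)[OF l] 2 pos[OF k0] by auto
      qed
      have "1 \<le> \<alpha> 0" by (rule bound[OF k0]) (use y0 2 g0 in auto)
      moreover have "\<alpha> 0 \<le> 1" using tb(1)[of 1] y1[of 0] 2 k0 by simp
      ultimately have \<alpha>0: "\<alpha> 0 = 1" by simp
      then have a0: "?a 0 = -1" "\<And>l. l \<in> {1..4} \<Longrightarrow> move k g \<alpha> l 0 = 1"
        using 2 g0 k0 unfolding move_def by auto
      note ar = arith(3)[OF _ _ _ a0(1)]
      have a12: "?a 1 = 1" "?a 2 = -1" using ar[OF j cj cj a0(2)[OF j]] by auto
      then have k3: "k = 3" using k unfolding move_def by (auto split: if_splits)
      have nz: "g i $ 0 \<noteq> 0" if "i < k" for i using all_global[OF that] a0(1) a12 by auto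
      have g1: "g 1 $ 0 = 1" "\<alpha> 1 = 1" using unit[of 1 1] a12 k3 by auto
      have g1': "g 1 $ l = 0" if l: "l \<in> {1..4}" for l
      proof -
        have "move k g \<alpha> l 1 = 0"
          using ar[OF l coupled_walk_move_global[OF walk nz l] coupled_walk_move_global[OF walk nz l] a0(2)[OF l]] by simp
        then show ?thesis using g1 k3 unfolding move_def by simp
      qed
      \<comment> \<open>All copies are at \<open>(0, 1)\<close>, and \<open>p\<close> can grow from
        0 to 2 while \<open>t\<close> grows from -1 to 1.\<close>
      have "2 \<le> \<alpha> 1"
        by (rule bound) (use k3 y1[of 0] y1 2 \<alpha>0 g0 g1 g1' in auto)
      then show ?thesis using g1 by simp
    qed
  qed
qed

subsection \<open>Neighbours of a simple vertex of a three-dimensional polyhedron\<close>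

lemma closed_seg_commute:
  assumes "x \<in> carrier_vec n" "y \<in> carrier_vec n"
  shows "closed_seg x y = closed_seg y x"
proof -
  have "closed_seg x y \<subseteq> closed_seg y x" if xy: "x \<in> carrier_vec n" "y \<in> carrier_vec n" for x y
  proof
    fix z assume "z \<in> closed_seg x y"
    then obtain s where "0 \<le> s" "s \<le> 1" "z = (1 - s) \<cdot>\<^sub>v x + s \<cdot>\<^sub>v y" unfolding closed_seg_def by auto
    moreover have "(1 - s) \<cdot>\<^sub>v x + s \<cdot>\<^sub>v y = (1 - (1 - s)) \<cdot>\<^sub>v y + (1 - s) \<cdot>\<^sub>v x"
      using xy by (intro eq_vecI) auto
    ultimately show "z \<in> closed_seg y x"
      unfolding closed_seg_def by (intro CollectI exI[of _ "1 - s"]) auto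
  qed
  then show ?thesis using assms by blast
qed

lemma adjacent_vertices_commute:
  assumes "P \<subseteq> carrier_vec n" and "adjacent_vertices P v w"
  shows "adjacent_vertices P w v"
proof -
  have "v \<in> carrier_vec n" "w \<in> carrier_vec n"
    using assms unfolding adjacent_vertices_def vertex_of_def by auto
  then show ?thesis
    using assms(2) closed_seg_commute unfolding adjacent_vertices_def by metis
qed

text \<open>A point of the edge close to \<open>v\<close> is the midpoint of
  \<open>v + \<epsilon> a\<close> and \<open>v + \<epsilon> b\<close>. The face property pulls both
  onto the edge, so \<open>a\<close> is parallel to \<open>w - v\<close>. Coinciding ends, where
  \<open>a = b\<close>, need a separate case because the open segment is then empty.\<close>

lemma adjacent_vertices_split:
  assumes P: "P \<subseteq> carrier_vec n" and adj: "adjacent_vertices P v w"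
    and ab: "a \<in> carrier_vec n" "b \<in> carrier_vec n" and w: "w = v + (a + b)"
    and \<epsilon>: "0 < \<epsilon>" "\<epsilon> \<le> 1" and mem: "v + \<epsilon> \<cdot>\<^sub>v a \<in> P" "v + \<epsilon> \<cdot>\<^sub>v b \<in> P"
  obtains \<mu> where "a = \<mu> \<cdot>\<^sub>v (a + b)"
proof -
  have v: "v \<in> carrier_vec n" and face: "vec_face_of (closed_seg v w) P"
    using adj P unfolding adjacent_vertices_def vertex_of_def by auto
  let ?m = "v + (\<epsilon> / 2) \<cdot>\<^sub>v (a + b)"
  have "?m = (1 - \<epsilon> / 2) \<cdot>\<^sub>v v + (\<epsilon> / 2) \<cdot>\<^sub>v w"
    unfolding w using v ab by (intro eq_vecI) (auto simp: algebra_simps)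
  then have m1: "?m \<in> closed_seg v w"
    unfolding closed_seg_def using \<epsilon> by (intro CollectI exI[of _ "\<epsilon> / 2"]) auto
  have "?m = (1 - 1/2) \<cdot>\<^sub>v (v + \<epsilon> \<cdot>\<^sub>v a) + (1/2) \<cdot>\<^sub>v (v + \<epsilon> \<cdot>\<^sub>v b)"
    using v ab by (intro eq_vecI) (auto simp: field_simps)
  then have m2: "?m \<in> closed_seg (v + \<epsilon> \<cdot>\<^sub>v a) (v + \<epsilon> \<cdot>\<^sub>v b)"
    unfolding closed_seg_def by (intro CollectI exI[of _ "1/2"]) auto
  show ?thesis
  proof (cases "?m = v + \<epsilon> \<cdot>\<^sub>v a \<or> ?m = v + \<epsilon> \<cdot>\<^sub>v b")
    case True
    have "a $ i = b $ i" if i: "i < n" for i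
    proof -
      have "?m $ i = (v + \<epsilon> \<cdot>\<^sub>v a) $ i \<or> ?m $ i = (v + \<epsilon> \<cdot>\<^sub>v b) $ i" using True by metis
      then have "\<epsilon> * (a $ i) = \<epsilon> * (b $ i)" using i v ab by (auto simp: field_simps)
      then show ?thesis using \<epsilon> by simp
    qed
    then have "a = (1/2) \<cdot>\<^sub>v (a + b)" using ab by (intro eq_vecI) (auto simp: field_simps)
    then show ?thesis by (rule that)
  next
    case False
    then have "?m \<in> open_seg (v + \<epsilon> \<cdot>\<^sub>v a) (v + \<epsilon> \<cdot>\<^sub>v b)" using m2 unfolding open_seg_def by blast
    then have "v + \<epsilon> \<cdot>\<^sub>v a \<in> closed_seg v w"
      using face mem m1 unfolding vec_face_of_def by blast
    then obtain s where s: "v + \<epsilon> \<cdot>\<^sub>v a = (1 - s) \<cdot>\<^sub>v v + s \<cdot>\<^sub>v w" unfolding closed_seg_def by auto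
    have "a $ i = (s / \<epsilon>) * (a $ i + b $ i)" if i: "i < n" for i
    proof -
      have "(v + \<epsilon> \<cdot>\<^sub>v a) $ i = ((1 - s) \<cdot>\<^sub>v v + s \<cdot>\<^sub>v w) $ i" using s by simp
      then have "\<epsilon> * (a $ i) = s * (a $ i + b $ i)"
        using i v ab unfolding w by (simp add: algebra_simps)
      then show ?thesis using \<epsilon> by (simp add: field_simps)
    qed
    then have "a = (s / \<epsilon>) \<cdot>\<^sub>v (a + b)" using ab by (intro eq_vecI) auto
    then show ?thesis by (rule that)
  qed
qed

text \<open>Segment convexity is used twice: along the side opposite \<open>v\<close>, then from
  \<open>v\<close> to the point \<open>?u\<close> on that side.\<close>

lemma convex_vecs_triangle:
  assumes P: "P \<subseteq> carrier_vec n" and conv: "convex_vecs P"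
    and e: "e \<in> carrier_vec n" "f \<in> carrier_vec n" and mem: "v \<in> P" "v + e \<in> P" "v + f \<in> P"
    and ab: "0 \<le> a" "0 \<le> b" "a + b \<le> 1"
  shows "v + (a \<cdot>\<^sub>v e + b \<cdot>\<^sub>v f) \<in> P"
proof (cases "a + b = 0")
  case True
  then have "a = 0" "b = 0" using ab by auto
  then have "v + (a \<cdot>\<^sub>v e + b \<cdot>\<^sub>v f) = v" using e mem P by (intro eq_vecI) auto
  then show ?thesis using mem by simp
next
  case False
  have v: "v \<in> carrier_vec n" using mem P by auto
  let ?s = "b / (a + b)"
  let ?u = "(1 - ?s) \<cdot>\<^sub>v (v + e) + ?s \<cdot>\<^sub>v (v + f)"
  have "?u \<in> closed_seg (v + e) (v + f)"
    unfolding closed_seg_def using ab False by (intro CollectI exI[of _ ?s]) auto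
  then have u: "?u \<in> P" using conv mem unfolding convex_vecs_def by blast
  have "v + (a \<cdot>\<^sub>v e + b \<cdot>\<^sub>v f) = (1 - (a + b)) \<cdot>\<^sub>v v + (a + b) \<cdot>\<^sub>v ?u"
  proof (intro eq_vecI)
    fix i assume "i < dim_vec ((1 - (a + b)) \<cdot>\<^sub>v v + (a + b) \<cdot>\<^sub>v ?u)"
    then have i: "i < n" using e by simp
    have "(a + b) * ?s = b" "(a + b) * (1 - ?s) = a" using False by (auto simp: field_simps)
    then have "(a + b) * ((1 - ?s) * (v $ i + e $ i) + ?s * (v $ i + f $ i))
      = a * (v $ i + e $ i) + b * (v $ i + f $ i)"
      by (metis (no_types, opaque_lifting) distrib_left mult.assoc)
    then show "(v + (a \<cdot>\<^sub>v e + b \<cdot>\<^sub>v f)) $ i = ((1 - (a + b)) \<cdot>\<^sub>v v + (a + b) \<cdot>\<^sub>v ?u) $ i"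
      using i v e by (simp add: algebra_simps)
  qed (use e v in auto)
  then have "v + (a \<cdot>\<^sub>v e + b \<cdot>\<^sub>v f) \<in> closed_seg v ?u"
    unfolding closed_seg_def using ab by (intro CollectI exI[of _ "a + b"]) auto
  then show ?thesis using conv mem u unfolding convex_vecs_def by blast
qed

text \<open>The displacement \<open>w - v\<close> splits into its \<open>e\<close>-part and the
  rest. If both were nonzero they would be parallel, against independence.\<close>

lemma adjacent_vertices_cone:
  assumes P: "P \<subseteq> carrier_vec n" and conv: "convex_vecs P" and adj: "adjacent_vertices P v w"
    and e: "e \<in> carrier_vec n" "f \<in> carrier_vec n" "h \<in> carrier_vec n"
    and mem: "v + e \<in> P" "v + f \<in> P" "v + h \<in> P"
    and l: "0 \<le> l" "0 \<le> m" "0 \<le> r" and w: "w = v + (l \<cdot>\<^sub>v e + (m \<cdot>\<^sub>v f + r \<cdot>\<^sub>v h))"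
    and indep: "\<And>a b c. a \<cdot>\<^sub>v e + (b \<cdot>\<^sub>v f + c \<cdot>\<^sub>v h) = 0\<^sub>v n \<Longrightarrow> a = 0 \<and> b = 0 \<and> c = 0"
  shows "l = 0 \<or> m = 0 \<and> r = 0"
proof -
  obtain \<epsilon> where \<epsilon>: "0 < \<epsilon>" "\<epsilon> \<le> 1" and small: "\<epsilon> * m + \<epsilon> * r \<le> 1" "\<epsilon> * l + 0 \<le> 1"
  proof
    \<comment> \<open>Small enough to bring both scaled parts into the triangles spanned at
      \<open>v\<close>.\<close>
    let ?\<epsilon> = "1 / (1 + l + m + r)"
    show "0 < ?\<epsilon>" "?\<epsilon> \<le> 1" "?\<epsilon> * l + 0 \<le> 1" using l by (auto simp: divide_simps)
    have "?\<epsilon> * (m + r) \<le> 1" using l by (simp add: divide_simps)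
    then show "?\<epsilon> * m + ?\<epsilon> * r \<le> 1" by (simp only: distrib_left)
  qed
  have v: "v \<in> P" "v \<in> carrier_vec n" using adj P unfolding adjacent_vertices_def vertex_of_def by auto
  have sc: "\<epsilon> \<cdot>\<^sub>v (m \<cdot>\<^sub>v f + r \<cdot>\<^sub>v h) = (\<epsilon> * m) \<cdot>\<^sub>v f + (\<epsilon> * r) \<cdot>\<^sub>v h"
    "\<epsilon> \<cdot>\<^sub>v (l \<cdot>\<^sub>v e) = (\<epsilon> * l) \<cdot>\<^sub>v e + 0 \<cdot>\<^sub>v e"
    using e by (auto intro!: eq_vecI simp: algebra_simps)
  have "v + \<epsilon> \<cdot>\<^sub>v (m \<cdot>\<^sub>v f + r \<cdot>\<^sub>v h) \<in> P"
    unfolding sc using l \<epsilon> small by (intro convex_vecs_triangle[OF P conv e(2,3) v(1) mem(2,3)]) auto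
  moreover have "v + \<epsilon> \<cdot>\<^sub>v (l \<cdot>\<^sub>v e) \<in> P"
    unfolding sc using l \<epsilon> small by (intro convex_vecs_triangle[OF P conv e(1,1) v(1) mem(1,1)]) auto
  ultimately obtain \<mu> where \<mu>: "l \<cdot>\<^sub>v e = \<mu> \<cdot>\<^sub>v (l \<cdot>\<^sub>v e + (m \<cdot>\<^sub>v f + r \<cdot>\<^sub>v h))"
    using adjacent_vertices_split[OF P adj _ _ w \<epsilon>] e by auto
  have "(l - \<mu> * l) \<cdot>\<^sub>v e + ((- \<mu> * m) \<cdot>\<^sub>v f + (- \<mu> * r) \<cdot>\<^sub>v h) = 0\<^sub>v n"
  proof (intro eq_vecI)
    fix i assume "i < dim_vec (0\<^sub>v n)"
    then have i: "i < n" by simp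
    have "(l \<cdot>\<^sub>v e) $ i = (\<mu> \<cdot>\<^sub>v (l \<cdot>\<^sub>v e + (m \<cdot>\<^sub>v f + r \<cdot>\<^sub>v h))) $ i" using \<mu> by simp
    then show "((l - \<mu> * l) \<cdot>\<^sub>v e + ((- \<mu> * m) \<cdot>\<^sub>v f + (- \<mu> * r) \<cdot>\<^sub>v h)) $ i = 0\<^sub>v n $ i"
      using i e by (simp add: algebra_simps)
  qed (use e in auto)
  from indep[OF this] show ?thesis by auto
qed

lemma vertex_not_inside_ray:
  assumes v: "v \<in> P" "v \<in> carrier_vec n" and e: "e \<in> carrier_vec n" "e \<noteq> 0\<^sub>v n"
    and "0 < l" "l < s" "v + s \<cdot>\<^sub>v e \<in> P"
  shows "\<not> vertex_of (v + l \<cdot>\<^sub>v e) P"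
proof
  assume "vertex_of (v + l \<cdot>\<^sub>v e) P"
  moreover have "v + l \<cdot>\<^sub>v e \<in> open_seg v (v + s \<cdot>\<^sub>v e)"
  proof -
    obtain i where i: "i < n" "e $ i \<noteq> 0"
      using e by (metis carrier_vecD eq_vecI index_zero_vec(1,2))
    have "v + l \<cdot>\<^sub>v e = (1 - l / s) \<cdot>\<^sub>v v + (l / s) \<cdot>\<^sub>v (v + s \<cdot>\<^sub>v e)"
      using v e assms(5,6) by (intro eq_vecI) (auto simp: field_simps)
    then have "v + l \<cdot>\<^sub>v e \<in> closed_seg v (v + s \<cdot>\<^sub>v e)"
      unfolding closed_seg_def using assms(5,6) by (intro CollectI exI[of _ "l / s"]) auto
    moreover have "(v + l \<cdot>\<^sub>v e) $ i \<noteq> v $ i" "(v + l \<cdot>\<^sub>v e) $ i \<noteq> (v + s \<cdot>\<^sub>v e) $ i"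
      using v e i assms(5,6) by auto
    ultimately show ?thesis unfolding open_seg_def by auto
  qed
  ultimately show False using assms unfolding vertex_of_def by blast
qed

text \<open>An adjacent vertex must lie on a single one of the three directions. The ray along
  \<open>h\<close> contains no vertex other than \<open>v\<close>, and along \<open>e\<close> and
  \<open>f\<close> only the end of the bounded edge qualifies.\<close>

lemma simple_vertex_neighbours:
  assumes P: "P \<subseteq> carrier_vec n" and conv: "convex_vecs P" and adj: "adjacent_vertices P v w"
    and e: "e \<in> carrier_vec n" "f \<in> carrier_vec n" "h \<in> carrier_vec n"
    and mem: "v + e \<in> P" "v + f \<in> P" and ray: "\<And>s. 0 \<le> s \<Longrightarrow> v + s \<cdot>\<^sub>v h \<in> P"
    and max: "\<And>s. 1 < s \<Longrightarrow> v + s \<cdot>\<^sub>v e \<notin> P" "\<And>s. 1 < s \<Longrightarrow> v + s \<cdot>\<^sub>v f \<notin> P"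
    and l: "0 \<le> l" "0 \<le> m" "0 \<le> r" and w: "w = v + (l \<cdot>\<^sub>v e + (m \<cdot>\<^sub>v f + r \<cdot>\<^sub>v h))"
    and indep: "\<And>a b c. a \<cdot>\<^sub>v e + (b \<cdot>\<^sub>v f + c \<cdot>\<^sub>v h) = 0\<^sub>v n \<Longrightarrow> a = 0 \<and> b = 0 \<and> c = 0"
  shows "w = v + e \<or> w = v + f"
proof -
  have v: "v \<in> P" "v \<in> carrier_vec n" and vw: "v \<noteq> w" and wv: "vertex_of w P" and wP: "w \<in> P"
    using adj P unfolding adjacent_vertices_def vertex_of_def by auto
  have h: "v + h \<in> P" using ray[of 1] by simp
  have perm: "l \<cdot>\<^sub>v e + (m \<cdot>\<^sub>v f + r \<cdot>\<^sub>v h) = m \<cdot>\<^sub>v f + (l \<cdot>\<^sub>v e + r \<cdot>\<^sub>v h)" for l m r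
    using e by (intro eq_vecI) auto
  have c1: "l = 0 \<or> m = 0 \<and> r = 0"
    by (rule adjacent_vertices_cone[OF P conv adj e mem h l w indep])
  have c2: "m = 0 \<or> l = 0 \<and> r = 0"
  proof (rule adjacent_vertices_cone[OF P conv adj e(2,1,3) mem(2,1) h l(2,1,3)])
    show "w = v + (m \<cdot>\<^sub>v f + (l \<cdot>\<^sub>v e + r \<cdot>\<^sub>v h))" using w perm by simp
    show "a = 0 \<and> b = 0 \<and> c = 0" if "a \<cdot>\<^sub>v f + (b \<cdot>\<^sub>v e + c \<cdot>\<^sub>v h) = 0\<^sub>v n" for a b c
      using indep[of b a c] that perm by simp
  qed
  have zero: "0 \<cdot>\<^sub>v u = 0\<^sub>v n" if "u \<in> carrier_vec n" for u :: "real vec"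
    using that by (intro eq_vecI) auto
  have ne: "e \<noteq> 0\<^sub>v n" "f \<noteq> 0\<^sub>v n" "h \<noteq> 0\<^sub>v n"
    using indep[of 1 0 0] indep[of 0 1 0] indep[of 0 0 1] zero e by auto
  have on_edge: "w = v + d" if d: "d \<in> carrier_vec n" "d \<noteq> 0\<^sub>v n" "v + d \<in> P"
    and max: "\<And>s. 1 < s \<Longrightarrow> v + s \<cdot>\<^sub>v d \<notin> P" and w: "w = v + x \<cdot>\<^sub>v d" "0 < x" for d x
  proof -
    have "x \<le> 1" using max[of x] w wP by fastforce
    moreover have "\<not> x < 1" using vertex_not_inside_ray[OF v d(1,2) w(2), of 1] wv w(1) d(3) by auto
    ultimately show ?thesis using w by simp
  qed
  consider "l = 0" "m = 0" | "m = 0" "r = 0" | "l = 0" "r = 0" using c1 c2 by blast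
  then show ?thesis
  proof cases
    case 1
    have w': "w = v + r \<cdot>\<^sub>v h" unfolding w using 1 e zero by auto
    have "r \<noteq> 0" using vw v e zero unfolding w' by auto
    then show ?thesis
      using vertex_not_inside_ray[OF v e(3) ne(3), of r "r + 1"] ray[of "r + 1"] l wv w' by auto
  next
    case 2
    have w': "w = v + l \<cdot>\<^sub>v e" unfolding w using 2 e zero by auto
    have "l \<noteq> 0" using vw v e zero unfolding w' by auto
    then show ?thesis using on_edge[OF e(1) ne(1) mem(1) max(1) w'] l by auto
  next
    case 3
    have w': "w = v + m \<cdot>\<^sub>v f" unfolding w using 3 e zero by auto
    have "m \<noteq> 0" using vw v e zero unfolding w' by auto
    then show ?thesis using on_edge[OF e(2) ne(2) mem(2) max(2) w'] l by auto
  qed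
qed

subsection \<open>A three-dimensional polyhedron with two pentagons sharing a vertex\<close>

definition v3 :: "'a \<Rightarrow> 'a \<Rightarrow> 'a \<Rightarrow> 'a vec" where
  "v3 x y z = vec 3 (\<lambda>i. if i = 0 then x else if i = 1 then y else z)"

lemma v3_simps [simp]:
  "v3 x y z \<in> carrier_vec 3" "dim_vec (v3 x y z) = 3"
  "v3 x y z $ 0 = x" "v3 x y z $ Suc 0 = y" "v3 x y z $ 1 = y" "v3 x y z $ 2 = z"
  unfolding v3_def by auto

lemma less_3_iff: "i < 3 \<longleftrightarrow> i = 0 \<or> i = 1 \<or> i = (2::nat)" by auto

lemma vec3_eqI:
  assumes "u \<in> carrier_vec 3" "w \<in> carrier_vec 3" "u $ 0 = w $ 0" "u $ 1 = w $ 1" "u $ 2 = w $ 2"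
  shows "u = w"
  using assms by (intro eq_vecI) (auto simp: less_3_iff)

lemma v3_arith:
  "v3 x y z + v3 x' y' z' = v3 (x + x') (y + y') (z + z')"
  "v3 x y z - v3 x' y' z' = v3 (x - x') (y - y') (z - z')"
  "s \<cdot>\<^sub>v v3 x y z = v3 (s * x) (s * y) (s * z)"
  "rvec (v3 i j k) = v3 (real_of_int i) (real_of_int j) (real_of_int k)"
  by (rule vec3_eqI; simp)+

lemma v3_eq_iff: "v3 x y z = v3 x' y' z' \<longleftrightarrow> x = x' \<and> y = y' \<and> z = z'"
proof
  assume eq: "v3 x y z = v3 x' y' z'"
  have "v3 x y z $ 0 = v3 x' y' z' $ 0" "v3 x y z $ 1 = v3 x' y' z' $ 1" "v3 x y z $ 2 = v3 x' y' z' $ 2"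
    unfolding eq by simp_all
  then show "x = x' \<and> y = y' \<and> z = z'" by simp
qed simp

lemma vec3_cases:
  assumes "u \<in> carrier_vec 3"
  obtains x y z where "u = v3 x y z"
  using assms vec3_eqI[of u "v3 (u $ 0) (u $ 1) (u $ 2)"] by auto

abbreviation pentagons_A :: "int mat" where "pentagons_A \<equiv> 0\<^sub>m 0 3"

text \<open>Consecutive rows are exchanged by \<open>(x, y, z) \<mapsto> (- x, - y, z)\<close>.
  Together with \<open>pentagons_d\<close> they make the face \<open>z = - y\<close> a pentagon with
  \<open>(x, z)\<close>-corners \<open>(0, 0)\<close>, \<open>(3, 3)\<close>, \<open>(2, 3)\<close>,
  \<open>(0, 2)\<close>, \<open>(-1, 1)\<close>. The face \<open>z = y\<close> is its image and
  meets it only in the origin.\<close>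

definition pentagons_B :: "int mat" where
  "pentagons_B = mat 10 3 (\<lambda>(r, c). [[1, 0, -1], [-1, 0, -1], [0, 1, -1], [0, -1, -1], [1, 2, -1], [-1, -2, -1],
     [1, 3, -1], [-1, -3, -1], [0, 1, 0], [0, -1, 0]] ! r ! c)"

definition pentagons_d :: "real vec" where
  "pentagons_d = vec 10 (\<lambda>r. [0, 0, 0, 0, 2, 2, 4, 4, 3, 3] ! r)"

abbreviation pentagons_P :: "real vec set" where "pentagons_P \<equiv> polyhedron_of pentagons_A pentagons_B no_rhs pentagons_d"

lemma less_10_iff: "r < (10::nat) \<longleftrightarrow> r \<in> {0, 1, 2, 3, 4, 5, 6, 7, 8, 9}"
  by (simp only: insert_iff empty_iff simp_thms) presburger

lemma All_less_10:
  "(\<forall>r<10::nat. Q r) \<longleftrightarrow> Q 0 \<and> Q 1 \<and> Q 2 \<and> Q 3 \<and> Q 4 \<and> Q 5 \<and> Q 6 \<and> Q 7 \<and> Q 8 \<and> Q 9"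
  unfolding less_10_iff by blast

lemma pentagons_B_carrier: "pentagons_B \<in> carrier_mat 10 3" "dim_row pentagons_B = 10" "dim_col pentagons_B = 3"
  unfolding pentagons_B_def by auto

lemma pentagons_B_mult:
  "\<forall>r<10. (rmat pentagons_B *\<^sub>v v3 x y z) $ r =
    [x - z, - x - z, y - z, - y - z, x + 2 * y - z, - x - 2 * y - z,
     x + 3 * y - z, - x - 3 * y - z, y, - y] ! r"
proof -
  have "{0..<3::nat} = {0, 1, 2}" by auto
  then show ?thesis
    unfolding All_less_10 using pentagons_B_carrier by (simp add: scalar_prod_def pentagons_B_def)
qed

lemma polyhedron_data_pentagons: "polyhedron_data 3 pentagons_A pentagons_B no_rhs pentagons_d"
  unfolding polyhedron_data_def pentagons_d_def no_rhs_def using pentagons_B_carrier by simp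

lemma mem_pentagons_P:
  "v3 x y z \<in> pentagons_P \<longleftrightarrow> x \<le> z \<and> - x \<le> z \<and> y \<le> z \<and> - y \<le> z \<and> x + 2 * y - z \<le> 2 \<and> - x - 2 * y - z \<le> 2 \<and>
    x + 3 * y - z \<le> 4 \<and> - x - 3 * y - z \<le> 4 \<and> y \<le> 3 \<and> - y \<le> 3"
proof -
  have "rmat pentagons_B *\<^sub>v v3 x y z \<le> pentagons_d \<longleftrightarrow> (\<forall>r<10. (rmat pentagons_B *\<^sub>v v3 x y z) $ r \<le> pentagons_d $ r)"
    unfolding less_eq_vec_def using pentagons_B_carrier by (simp add: pentagons_d_def del: index_mult_mat_vec)
  also have "\<dots> \<longleftrightarrow> (\<forall>r<10. [x - z, - x - z, y - z, - y - z, x + 2 * y - z, - x - 2 * y - z,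
     x + 3 * y - z, - x - 3 * y - z, y, - y] ! r \<le> pentagons_d $ r)"
    using pentagons_B_mult[of x y z] by (simp del: index_mult_mat_vec)
  also have "\<dots> \<longleftrightarrow> x \<le> z \<and> - x \<le> z \<and> y \<le> z \<and> - y \<le> z \<and> x + 2 * y - z \<le> 2 \<and> - x - 2 * y - z \<le> 2 \<and>
    x + 3 * y - z \<le> 4 \<and> - x - 3 * y - z \<le> 4 \<and> y \<le> 3 \<and> - y \<le> 3"
    unfolding All_less_10 pentagons_d_def by simp
  finally show ?thesis unfolding polyhedron_of_def no_rhs_def by (auto intro!: eq_vecI)
qed

lemma pentagons_P_subset: "pentagons_P \<subseteq> carrier_vec 3"
  using polyhedron_of_subset[of pentagons_A] by simp

lemma convex_pentagons_P: "convex_vecs pentagons_P"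
  by (rule convex_polyhedron_of[OF polyhedron_data_pentagons])

lemma pentagons_neighbours:
  assumes adj: "adjacent_vertices pentagons_P (v3 x y z) w"
    and mem: "v3 (x + e0) (y + e1) (z + e2) \<in> pentagons_P" "v3 (x + f0) (y + f1) (z + f2) \<in> pentagons_P"
    and ray: "\<And>s. 0 \<le> s \<Longrightarrow> v3 (x + s * h0) (y + s * h1) (z + s * h2) \<in> pentagons_P"
    and max: "\<And>s. 1 < s \<Longrightarrow> v3 (x + s * e0) (y + s * e1) (z + s * e2) \<notin> pentagons_P"
      "\<And>s. 1 < s \<Longrightarrow> v3 (x + s * f0) (y + s * f1) (z + s * f2) \<notin> pentagons_P"
    and cone: "\<And>u0 u1 u2. v3 u0 u1 u2 \<in> pentagons_P \<Longrightarrow> \<exists>l m r. 0 \<le> l \<and> 0 \<le> m \<and> 0 \<le> r \<and>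
      u0 = x + (l * e0 + (m * f0 + r * h0)) \<and> u1 = y + (l * e1 + (m * f1 + r * h1)) \<and>
      u2 = z + (l * e2 + (m * f2 + r * h2))"
    and indep: "\<And>a b c. a * e0 + (b * f0 + c * h0) = 0 \<Longrightarrow> a * e1 + (b * f1 + c * h1) = 0 \<Longrightarrow>
      a * e2 + (b * f2 + c * h2) = 0 \<Longrightarrow> a = 0 \<and> b = 0 \<and> c = 0"
  shows "w = v3 (x + e0) (y + e1) (z + e2) \<or> w = v3 (x + f0) (y + f1) (z + f2)"
proof -
  have wP: "w \<in> pentagons_P" using adj unfolding adjacent_vertices_def vertex_of_def by simp
  then obtain u0 u1 u2 where u: "w = v3 u0 u1 u2" using vec3_cases pentagons_P_subset by blast
  then obtain l m r where lmr: "0 \<le> l" "0 \<le> m" "0 \<le> r" "u0 = x + (l * e0 + (m * f0 + r * h0))"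
    "u1 = y + (l * e1 + (m * f1 + r * h1))" "u2 = z + (l * e2 + (m * f2 + r * h2))"
    using cone wP by blast
  have "w = v3 x y z + v3 e0 e1 e2 \<or> w = v3 x y z + v3 f0 f1 f2"
  proof (rule simple_vertex_neighbours[OF pentagons_P_subset convex_pentagons_P adj, where h = "v3 h0 h1 h2"])
    show "w = v3 x y z + (l \<cdot>\<^sub>v v3 e0 e1 e2 + (m \<cdot>\<^sub>v v3 f0 f1 f2 + r \<cdot>\<^sub>v v3 h0 h1 h2))"
      unfolding u lmr by (simp add: v3_arith)
    have "0\<^sub>v 3 = v3 0 0 (0::real)" by (rule vec3_eqI) auto
    then show "a = 0 \<and> b = 0 \<and> c = 0"
      if "a \<cdot>\<^sub>v v3 e0 e1 e2 + (b \<cdot>\<^sub>v v3 f0 f1 f2 + c \<cdot>\<^sub>v v3 h0 h1 h2) = 0\<^sub>v 3" for a b c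
      using that indep[of a b c] by (simp add: v3_arith v3_eq_iff)
  qed (use mem ray max lmr in \<open>simp_all add: v3_arith\<close>)
  then show ?thesis by (simp add: v3_arith)
qed

text \<open>
  The lemmas below treat both pentagons at once: \<open>s\<close> is the sign of the symmetry
  \<open>(x, y, z) \<mapsto> (- x, - y, z)\<close>, which exchanges them.
\<close>

lemma neighbours_start:
  assumes "adjacent_vertices pentagons_P (v3 (2 * s) (-3 * s) 3) w" and s: "s = 1 \<or> s = -1"
  shows "w = v3 (3 * s) (-3 * s) 3 \<or> w = v3 0 (-2 * s) 2"
proof -
  have "w = v3 (2 * s + s) (-3 * s + 0) (3 + 0) \<or> w = v3 (2 * s + -2 * s) (-3 * s + s) (3 + -1)"
  proof (rule pentagons_neighbours[OF assms(1), where ?h0.0 = "-s" and ?h1.0 = 0 and ?h2.0 = 1])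
    fix u0 u1 u2 assume mem: "v3 u0 u1 u2 \<in> pentagons_P"
    show "\<exists>l m r. 0 \<le> l \<and> 0 \<le> m \<and> 0 \<le> r \<and> u0 = 2 * s + (l * s + (m * (-2 * s) + r * - s)) \<and>
      u1 = -3 * s + (l * 0 + (m * s + r * 0)) \<and> u2 = 3 + (l * 0 + (m * -1 + r * 1))"
      \<comment> \<open>The coefficients are the slacks of the three constraints tight at the
        vertex: each direction raises one slack by 1 and keeps the other two at 0.\<close>
      by (rule exI[of _ "u2 + s * u0 + 3 * s * u1 + 4"], rule exI[of _ "s * u1 + 3"],
          rule exI[of _ "u2 + s * u1"]) (use mem s in \<open>auto simp: mem_pentagons_P\<close>)
  qed (use s in \<open>auto simp: mem_pentagons_P\<close>)
  then show ?thesis by auto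
qed

lemma neighbours_corner:
  assumes "adjacent_vertices pentagons_P (v3 (3 * s) (-3 * s) 3) w" and s: "s = 1 \<or> s = -1"
  shows "w = v3 (2 * s) (-3 * s) 3 \<or> w = v3 0 0 0"
proof -
  have "w = v3 (3 * s + -s) (-3 * s + 0) (3 + 0) \<or> w = v3 (3 * s + -3 * s) (-3 * s + 3 * s) (3 + -3)"
  proof (rule pentagons_neighbours[OF assms(1), where ?h0.0 = s and ?h1.0 = 0 and ?h2.0 = 1])
    fix u0 u1 u2 assume mem: "v3 u0 u1 u2 \<in> pentagons_P"
    show "\<exists>l m r. 0 \<le> l \<and> 0 \<le> m \<and> 0 \<le> r \<and> u0 = 3 * s + (l * - s + (m * (-3 * s) + r * s)) \<and>
      u1 = -3 * s + (l * 0 + (m * (3 * s) + r * 0)) \<and> u2 = 3 + (l * 0 + (m * -3 + r * 1))"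
      \<comment> \<open>Slacks again; the second is divided by 3 because the edge to the origin
        raises it by 3.\<close>
      by (rule exI[of _ "u2 - s * u0"], rule exI[of _ "s * u1 / 3 + 1"],
          rule exI[of _ "u2 + s * u1"]) (use mem s in \<open>auto simp: mem_pentagons_P\<close>)
  qed (use s in \<open>auto simp: mem_pentagons_P\<close>)
  then show ?thesis by auto
qed

lemma neighbours_far:
  assumes "adjacent_vertices pentagons_P (v3 0 (-2 * s) 2) w" and s: "s = 1 \<or> s = -1"
  shows "w = v3 (2 * s) (-3 * s) 3 \<or> w = v3 (-s) (-s) 1"
proof -
  have "w = v3 (0 + 2 * s) (-2 * s + -s) (2 + 1) \<or> w = v3 (0 + -s) (-2 * s + s) (2 + -1)"
  proof (rule pentagons_neighbours[OF assms(1), where ?h0.0 = "-s" and ?h1.0 = 0 and ?h2.0 = 1])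
    fix u0 u1 u2 assume mem: "v3 u0 u1 u2 \<in> pentagons_P"
    show "\<exists>l m r. 0 \<le> l \<and> 0 \<le> m \<and> 0 \<le> r \<and> u0 = 0 + (l * (2 * s) + (m * - s + r * - s)) \<and>
      u1 = -2 * s + (l * - s + (m * s + r * 0)) \<and> u2 = 2 + (l * 1 + (m * -1 + r * 1))"
      by (rule exI[of _ "u2 + s * u0 + 2 * s * u1 + 2"], rule exI[of _ "u2 + s * u0 + 3 * s * u1 + 4"],
          rule exI[of _ "u2 + s * u1"]) (use mem s in \<open>auto simp: mem_pentagons_P\<close>)
  qed (use s in \<open>auto simp: mem_pentagons_P\<close>)
  then show ?thesis by auto
qed

section \<open>Vertices, edges and circuits of the walk of length four\<close>

lemma affine_pentagons: "affine_fun 3 (\<lambda>u. A * u $ 0 + B * u $ 1 + C * u $ 2)"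
  unfolding affine_fun_def by (auto simp: algebra_simps)

lemma vertex_pentagons_PI:
  assumes "v3 x y z \<in> pentagons_P"
    and "\<And>u0 u1 u2. v3 u0 u1 u2 \<in> pentagons_P \<Longrightarrow> A * u0 + B * u1 + C * u2 \<le> A * x + B * y + C * z"
    and "\<And>u0 u1 u2. v3 u0 u1 u2 \<in> pentagons_P \<Longrightarrow> A * u0 + B * u1 + C * u2 = A * x + B * y + C * z \<Longrightarrow>
      u0 = x \<and> u1 = y \<and> u2 = z"
  shows "vertex_of (v3 x y z) pentagons_P"
proof (rule vertex_ofI[OF pentagons_P_subset affine_pentagons[of A B C] assms(1)])
  fix u assume u: "u \<in> pentagons_P"
  then obtain u0 u1 u2 where eq: "u = v3 u0 u1 u2" using vec3_cases pentagons_P_subset by blast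
  show "A * u $ 0 + B * u $ 1 + C * u $ 2 \<le> A * v3 x y z $ 0 + B * v3 x y z $ 1 + C * v3 x y z $ 2"
    using assms(2) u unfolding eq by simp
  show "u = v3 x y z"
    if "A * u $ 0 + B * u $ 1 + C * u $ 2 = A * v3 x y z $ 0 + B * v3 x y z $ 1 + C * v3 x y z $ 2"
    using assms(3)[of u0 u1 u2] u that unfolding eq by simp
qed

lemma adjacent_pentagons_PI:
  assumes v: "vertex_of (v3 x y z) pentagons_P" "vertex_of (v3 x' y' z') pentagons_P" "(x, y, z) \<noteq> (x', y', z')"
    and "A * x + B * y + C * z = A * x' + B * y' + C * z'"
    and le: "\<And>u0 u1 u2. v3 u0 u1 u2 \<in> pentagons_P \<Longrightarrow> A * u0 + B * u1 + C * u2 \<le> A * x' + B * y' + C * z'"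
    and eq: "\<And>u0 u1 u2. v3 u0 u1 u2 \<in> pentagons_P \<Longrightarrow> A * u0 + B * u1 + C * u2 = A * x' + B * y' + C * z' \<Longrightarrow>
      \<exists>s. 0 \<le> s \<and> s \<le> 1 \<and> u0 = (1 - s) * x + s * x' \<and> u1 = (1 - s) * y + s * y' \<and> u2 = (1 - s) * z + s * z'"
  shows "adjacent_vertices pentagons_P (v3 x y z) (v3 x' y' z')"
proof (rule adjacent_verticesI[OF pentagons_P_subset affine_pentagons[of A B C] convex_pentagons_P v(1,2)])
  show "v3 x y z \<noteq> v3 x' y' z'" using v(3) by (simp add: v3_eq_iff)
  fix u assume u: "u \<in> pentagons_P"
  then obtain u0 u1 u2 where ue: "u = v3 u0 u1 u2" using vec3_cases pentagons_P_subset by blast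
  show "A * u $ 0 + B * u $ 1 + C * u $ 2
    \<le> A * v3 x' y' z' $ 0 + B * v3 x' y' z' $ 1 + C * v3 x' y' z' $ 2"
    using le u unfolding ue by simp
  assume "A * u $ 0 + B * u $ 1 + C * u $ 2
    = A * v3 x' y' z' $ 0 + B * v3 x' y' z' $ 1 + C * v3 x' y' z' $ 2"
  then obtain s where s: "0 \<le> s" "s \<le> 1" "u0 = (1 - s) * x + s * x'" "u1 = (1 - s) * y + s * y'"
    "u2 = (1 - s) * z + s * z'"
    using eq[of u0 u1 u2] u unfolding ue by auto
  then show "u \<in> closed_seg (v3 x y z) (v3 x' y' z')"
    unfolding closed_seg_def ue by (intro CollectI exI[of _ s]) (simp add: v3_arith)
qed (use assms(4) in simp)

text \<open>Up to scaling, each functional is the sum of rows tight at the vertex, which are the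
  inequalities in \<open>h\<close>.\<close>

lemma vertices_pentagons_P:
  shows "vertex_of (v3 2 (-3) 3) pentagons_P" and "vertex_of (v3 3 (-3) 3) pentagons_P" and "vertex_of (v3 0 0 0) pentagons_P"
    and "vertex_of (v3 (-3) 3 3) pentagons_P" and "vertex_of (v3 (-2) 3 3) pentagons_P"
proof -
  show "vertex_of (v3 2 (-3) 3) pentagons_P"
  proof (rule vertex_pentagons_PI[where A = "-1" and B = "-5" and C = "-2"])
    fix u0 u1 u2 assume "v3 u0 u1 u2 \<in> pentagons_P"
    then have h: "- u1 \<le> 3" "- u1 \<le> u2" "- u0 - 3 * u1 - u2 \<le> 4" unfolding mem_pentagons_P by blast+
    show "-1 * u0 + -5 * u1 + -2 * u2 \<le> -1 * 2 + -5 * -3 + -2 * 3" using h by linarith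
    assume "-1 * u0 + -5 * u1 + -2 * u2 = -1 * 2 + -5 * -3 + -2 * 3"
    then show "u0 = 2 \<and> u1 = -3 \<and> u2 = 3" using h by linarith
  qed (simp add: mem_pentagons_P)
  show "vertex_of (v3 3 (-3) 3) pentagons_P"
  proof (rule vertex_pentagons_PI[where A = "1" and B = "-2" and C = "-2"])
    fix u0 u1 u2 assume "v3 u0 u1 u2 \<in> pentagons_P"
    then have h: "- u1 \<le> 3" "- u1 \<le> u2" "u0 \<le> u2" unfolding mem_pentagons_P by blast+
    show "1 * u0 + -2 * u1 + -2 * u2 \<le> 1 * 3 + -2 * -3 + -2 * 3" using h by linarith
    assume "1 * u0 + -2 * u1 + -2 * u2 = 1 * 3 + -2 * -3 + -2 * 3"
    then show "u0 = 3 \<and> u1 = -3 \<and> u2 = 3" using h by linarith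
  qed (simp add: mem_pentagons_P)
  show "vertex_of (v3 0 0 0) pentagons_P"
  proof (rule vertex_pentagons_PI[where A = "0" and B = "0" and C = "-1"])
    fix u0 u1 u2 assume "v3 u0 u1 u2 \<in> pentagons_P"
    then have h: "u0 \<le> u2" "- u0 \<le> u2" "u1 \<le> u2" "- u1 \<le> u2" unfolding mem_pentagons_P by blast+
    show "0 * u0 + 0 * u1 + -1 * u2 \<le> 0 * 0 + 0 * 0 + -1 * 0" using h by linarith
    assume "0 * u0 + 0 * u1 + -1 * u2 = 0 * 0 + 0 * 0 + -1 * 0"
    then show "u0 = 0 \<and> u1 = 0 \<and> u2 = 0" using h by linarith
  qed (simp add: mem_pentagons_P)
  show "vertex_of (v3 (-3) 3 3) pentagons_P"
  proof (rule vertex_pentagons_PI[where A = "-1" and B = "2" and C = "-2"])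
    fix u0 u1 u2 assume "v3 u0 u1 u2 \<in> pentagons_P"
    then have h: "u1 \<le> 3" "u1 \<le> u2" "- u0 \<le> u2" unfolding mem_pentagons_P by blast+
    show "-1 * u0 + 2 * u1 + -2 * u2 \<le> -1 * -3 + 2 * 3 + -2 * 3" using h by linarith
    assume "-1 * u0 + 2 * u1 + -2 * u2 = -1 * -3 + 2 * 3 + -2 * 3"
    then show "u0 = -3 \<and> u1 = 3 \<and> u2 = 3" using h by linarith
  qed (simp add: mem_pentagons_P)
  show "vertex_of (v3 (-2) 3 3) pentagons_P"
  proof (rule vertex_pentagons_PI[where A = "1" and B = "5" and C = "-2"])
    fix u0 u1 u2 assume "v3 u0 u1 u2 \<in> pentagons_P"
    then have h: "u1 \<le> 3" "u1 \<le> u2" "u0 + 3 * u1 - u2 \<le> 4" unfolding mem_pentagons_P by blast+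
    show "1 * u0 + 5 * u1 + -2 * u2 \<le> 1 * -2 + 5 * 3 + -2 * 3" using h by linarith
    assume "1 * u0 + 5 * u1 + -2 * u2 = 1 * -2 + 5 * 3 + -2 * 3"
    then show "u0 = -2 \<and> u1 = 3 \<and> u2 = 3" using h by linarith
  qed (simp add: mem_pentagons_P)
qed

text \<open>Each functional is the sum of the two rows tight along the edge. The further
  inequalities in \<open>h\<close> bound the segment parameter.\<close>

lemma edges_pentagons_P:
  shows "adjacent_vertices pentagons_P (v3 2 (-3) 3) (v3 3 (-3) 3)"
    and "adjacent_vertices pentagons_P (v3 3 (-3) 3) (v3 0 0 0)"
    and "adjacent_vertices pentagons_P (v3 0 0 0) (v3 (-3) 3 3)"
    and "adjacent_vertices pentagons_P (v3 (-3) 3 3) (v3 (-2) 3 3)"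
proof -
  show "adjacent_vertices pentagons_P (v3 2 (-3) 3) (v3 3 (-3) 3)"
  proof (rule adjacent_pentagons_PI[OF vertices_pentagons_P(1,2), where A = "0" and B = "-2" and C = "-1"])
    fix u0 u1 u2 assume "v3 u0 u1 u2 \<in> pentagons_P"
    then have h: "- u1 \<le> 3" "- u1 \<le> u2" "u0 \<le> u2" "- u0 - 3 * u1 - u2 \<le> 4" unfolding mem_pentagons_P by blast+
    show "0 * u0 + -2 * u1 + -1 * u2 \<le> 0 * 3 + -2 * -3 + -1 * 3" using h by linarith
    assume eq: "0 * u0 + -2 * u1 + -1 * u2 = 0 * 3 + -2 * -3 + -1 * 3"
    have "u1 = -3" "u2 = 3" "2 \<le> u0" "u0 \<le> 3" using h eq by linarith+
    then have "0 \<le> u0 - 2 \<and> u0 - 2 \<le> 1 \<and> u0 = (1 - (u0 - 2)) * 2 + (u0 - 2) * 3 \<and> u1 = (1 - (u0 - 2)) * -3 + (u0 - 2) * -3 \<and> u2 = (1 - (u0 - 2)) * 3 + (u0 - 2) * 3"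
      by (simp add: algebra_simps)
    then show "\<exists>s. 0 \<le> s \<and> s \<le> 1 \<and> u0 = (1 - s) * 2 + s * 3 \<and> u1 = (1 - s) * -3 + s * -3 \<and> u2 = (1 - s) * 3 + s * 3" ..
  qed auto
  show "adjacent_vertices pentagons_P (v3 3 (-3) 3) (v3 0 0 0)"
  proof (rule adjacent_pentagons_PI[OF vertices_pentagons_P(2,3), where A = "1" and B = "-1" and C = "-2"])
    fix u0 u1 u2 assume "v3 u0 u1 u2 \<in> pentagons_P"
    then have h: "- u1 \<le> u2" "u0 \<le> u2" "- u0 \<le> u2" "- u1 \<le> 3" unfolding mem_pentagons_P by blast+
    show "1 * u0 + -1 * u1 + -2 * u2 \<le> 1 * 0 + -1 * 0 + -2 * 0" using h by linarith
    assume eq: "1 * u0 + -1 * u1 + -2 * u2 = 1 * 0 + -1 * 0 + -2 * 0"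
    have "u1 = - u0" "u2 = u0" "0 \<le> u0" "u0 \<le> 3" using h eq by linarith+
    then have "0 \<le> 1 - u0 / 3 \<and> 1 - u0 / 3 \<le> 1 \<and> u0 = (1 - (1 - u0 / 3)) * 3 + (1 - u0 / 3) * 0 \<and> u1 = (1 - (1 - u0 / 3)) * -3 + (1 - u0 / 3) * 0 \<and> u2 = (1 - (1 - u0 / 3)) * 3 + (1 - u0 / 3) * 0"
      by (simp add: algebra_simps)
    then show "\<exists>s. 0 \<le> s \<and> s \<le> 1 \<and> u0 = (1 - s) * 3 + s * 0 \<and> u1 = (1 - s) * -3 + s * 0 \<and> u2 = (1 - s) * 3 + s * 0" ..
  qed auto
  show "adjacent_vertices pentagons_P (v3 0 0 0) (v3 (-3) 3 3)"
  proof (rule adjacent_pentagons_PI[OF vertices_pentagons_P(3,4), where A = "-1" and B = "1" and C = "-2"])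
    fix u0 u1 u2 assume "v3 u0 u1 u2 \<in> pentagons_P"
    then have h: "u1 \<le> u2" "u0 \<le> u2" "- u0 \<le> u2" "u1 \<le> 3" unfolding mem_pentagons_P by blast+
    show "-1 * u0 + 1 * u1 + -2 * u2 \<le> -1 * -3 + 1 * 3 + -2 * 3" using h by linarith
    assume eq: "-1 * u0 + 1 * u1 + -2 * u2 = -1 * -3 + 1 * 3 + -2 * 3"
    have "u0 = - u1" "u2 = u1" "0 \<le> u1" "u1 \<le> 3" using h eq by linarith+
    then have "0 \<le> u1 / 3 \<and> u1 / 3 \<le> 1 \<and> u0 = (1 - (u1 / 3)) * 0 + (u1 / 3) * -3 \<and> u1 = (1 - (u1 / 3)) * 0 + (u1 / 3) * 3 \<and> u2 = (1 - (u1 / 3)) * 0 + (u1 / 3) * 3"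
      by (simp add: algebra_simps)
    then show "\<exists>s. 0 \<le> s \<and> s \<le> 1 \<and> u0 = (1 - s) * 0 + s * -3 \<and> u1 = (1 - s) * 0 + s * 3 \<and> u2 = (1 - s) * 0 + s * 3" ..
  qed auto
  show "adjacent_vertices pentagons_P (v3 (-3) 3 3) (v3 (-2) 3 3)"
  proof (rule adjacent_pentagons_PI[OF vertices_pentagons_P(4,5), where A = "0" and B = "2" and C = "-1"])
    fix u0 u1 u2 assume "v3 u0 u1 u2 \<in> pentagons_P"
    then have h: "u1 \<le> 3" "u1 \<le> u2" "- u0 \<le> u2" "u0 + 3 * u1 - u2 \<le> 4" unfolding mem_pentagons_P by blast+
    show "0 * u0 + 2 * u1 + -1 * u2 \<le> 0 * -2 + 2 * 3 + -1 * 3" using h by linarith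
    assume eq: "0 * u0 + 2 * u1 + -1 * u2 = 0 * -2 + 2 * 3 + -1 * 3"
    have "u1 = 3" "u2 = 3" "-3 \<le> u0" "u0 \<le> -2" using h eq by linarith+
    then have "0 \<le> u0 + 3 \<and> u0 + 3 \<le> 1 \<and> u0 = (1 - (u0 + 3)) * -3 + (u0 + 3) * -2 \<and> u1 = (1 - (u0 + 3)) * 3 + (u0 + 3) * 3 \<and> u2 = (1 - (u0 + 3)) * 3 + (u0 + 3) * 3"
      by (simp add: algebra_simps)
    then show "\<exists>s. 0 \<le> s \<and> s \<le> 1 \<and> u0 = (1 - s) * -3 + s * -2 \<and> u1 = (1 - s) * 3 + s * 3 \<and> u2 = (1 - s) * 3 + s * 3" ..
  qed auto
qed

lemma set_v3: "set\<^sub>v (v3 x y z) = {x, y, z}"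
proof -
  have "{..<3::nat} = {0, 1, 2}" by auto
  then show ?thesis unfolding vec_set_def by simp
qed

lemma circuit_pentagonsI:
  assumes "(x, y, z) \<in> {(1, 0, 0), (-1, 1, -1), (-1, 1, 1)}"
  shows "circuit pentagons_A pentagons_B (v3 x y z)"
proof (rule circuitI[where m = 10])
  show "pentagons_B \<in> carrier_mat 10 (dim_col pentagons_A)" using pentagons_B_carrier by simp
  show "rvec (v3 x y z) \<in> mat_kernel (rmat pentagons_A)"
    unfolding mat_kernel_def v3_arith by (auto intro!: eq_vecI)
  have "0\<^sub>v 3 = v3 0 0 (0::int)" by (rule vec3_eqI) auto
  then show "v3 x y z \<noteq> 0\<^sub>v (dim_col pentagons_A)" using assms by (auto simp: v3_eq_iff)
  show "Gcd (set\<^sub>v (v3 x y z)) = 1" using assms by (auto simp: set_v3)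
  fix u assume "u \<in> carrier_vec (dim_col pentagons_A)"
    and zero: "\<And>i. i < 10 \<Longrightarrow> (rmat pentagons_B *\<^sub>v rvec (v3 x y z)) $ i = 0 \<Longrightarrow> (rmat pentagons_B *\<^sub>v u) $ i = 0"
  then have "u \<in> carrier_vec 3" by simp
  then obtain u0 u1 u2 where u: "u = v3 u0 u1 u2" by (rule vec3_cases)
  let ?row = "\<lambda>x y z. [x - z, - x - z, y - z, - y - z, x + 2 * y - z, - x - 2 * y - z,
     x + 3 * y - z, - x - 3 * y - z, y, - y] :: real list"
  have imp: "?row u0 u1 u2 ! i = 0" if "i < 10" "?row x y z ! i = 0" for i
    using zero[of i] that pentagons_B_mult[of u0 u1 u2] pentagons_B_mult[of x y z] unfolding u v3_arith(4) by metis
  consider "x = 1" "y = 0" "z = 0" | "x = -1" "y = 1" "z = -1" | "x = -1" "y = 1" "z = 1"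
    using assms by auto
  then have "u = (u0 * x) \<cdot>\<^sub>v rvec (v3 x y z)"
  proof cases
    case 1
    then have "u1 = 0" "u2 = 0" using imp[of 2] imp[of 8] by simp_all
    then show ?thesis using 1 unfolding u by (simp add: v3_arith)
  next
    case 2
    then have "u1 = - u0" "u2 = u0" using imp[of 0] imp[of 3] by simp_all
    then show ?thesis using 2 unfolding u by (simp add: v3_arith)
  next
    case 3
    then have "u1 = - u0" "u2 = - u0" using imp[of 1] imp[of 2] by simp_all
    then show ?thesis using 3 unfolding u by (simp add: v3_arith)
  qed
  then show "\<exists>c. u = c \<cdot>\<^sub>v rvec (v3 x y z)" ..
qed

lemma CD_efm_pentagons_le:
  "CD {Edge, Feasible, Maximal} pentagons_A pentagons_B no_rhs pentagons_d (v3 2 (-3) 3) (v3 (-2) 3 3) \<le> enat 4"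
proof (rule CD_le)
  let ?y = "\<lambda>i. [v3 2 (-3) 3, v3 3 (-3) 3, v3 0 0 0, v3 (-3) 3 3, v3 (-2) 3 3] ! i"
  let ?g = "\<lambda>i. [v3 1 0 0, v3 (-1) 1 (-1), v3 (-1) 1 1, v3 1 0 0] ! i"
  let ?\<alpha> = "\<lambda>i. [1, 3, 3, 1] ! i"
  have less4: "(\<forall>i<4::nat. Q i) \<longleftrightarrow> Q 0 \<and> Q 1 \<and> Q 2 \<and> Q 3" for Q
    by (auto simp: less_Suc_eq numeral_eq_Suc)
  have le4: "(\<forall>i\<le>4::nat. Q i) \<longleftrightarrow> Q 0 \<and> Q 1 \<and> Q 2 \<and> Q 3 \<and> Q 4" for Q
    by (auto simp: le_Suc_eq numeral_eq_Suc)
  show "circuit_walk pentagons_A pentagons_B (v3 2 (-3) 3) (v3 (-2) 3 3) 4 ?y ?g ?\<alpha>"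
    unfolding circuit_walk_def less4 le4 by (simp add: v3_arith circuit_pentagonsI)
  fix p assume "p \<in> {Edge, Feasible, Maximal}"
  then show "has_property p pentagons_A pentagons_B no_rhs pentagons_d (v3 2 (-3) 3) (v3 (-2) 3 3) 4 ?y ?g ?\<alpha>"
    by (elim insertE emptyE; simp add: less4 le4 v3_arith edges_pentagons_P mem_pentagons_P)
qed

text \<open>Coprimality leaves one circuit per direction, so equal displacements come from equal
  circuits.\<close>

lemma circuit_along_first_axis:
  assumes "circuit pentagons_A pentagons_B g" and "0 < \<alpha>" and "v3 1 0 0 = \<alpha> \<cdot>\<^sub>v rvec g"
  shows "g = v3 1 0 0"
proof -
  have "g \<in> carrier_vec 3" using circuit_carrier[OF assms(1)] by simp
  then obtain a b c where g: "g = v3 a b c" using vec3_cases by blast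
  have abc: "\<alpha> * real_of_int a = 1" "b = 0" "c = 0"
    using assms(2,3) unfolding g v3_arith v3_eq_iff by auto
  then have "0 < real_of_int a" using assms(2) zero_less_mult_pos[of \<alpha> "real_of_int a"] by simp
  then have "0 < a" by simp
  moreover have "Gcd {a, b, c} = 1" using assms(1) unfolding circuit_def g set_v3 by simp
  ultimately have "a = 1" using abc by simp
  then show ?thesis using g abc by simp
qed

text \<open>The search runs from both ends. Lengths up to three leave no common vertex, and length
  four leaves only the route through the origin, whose first and last displacements are both
  \<open>v3 1 0 0\<close>.\<close>

lemma pentagons_edge_walk:
  assumes walk: "circuit_walk pentagons_A pentagons_B (v3 2 (-3) 3) (v3 (-2) 3 3) k y g \<alpha>"
    and edge: "has_property Edge pentagons_A pentagons_B no_rhs pentagons_d (v3 2 (-3) 3) (v3 (-2) 3 3) k y g \<alpha>"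
    and rep: "has_property NonRepetitive pentagons_A pentagons_B no_rhs pentagons_d (v3 2 (-3) 3) (v3 (-2) 3 3) k y g \<alpha>"
  shows "5 \<le> k"
proof (rule ccontr)
  assume "\<not> 5 \<le> k"
  have ends: "y 0 = v3 2 (-3) 3" "y k = v3 (-2) 3 3" using walk unfolding circuit_walk_def by auto
  have k0: "k \<noteq> 0"
  proof
    assume "k = 0"
    then show False using ends by (simp add: v3_eq_iff)
  qed
  have adj: "adjacent_vertices pentagons_P (y i) (y (Suc i))" if "i < k" for i using edge that by simp
  note nb1 = neighbours_start[of 1, simplified] neighbours_corner[of 1, simplified]
    neighbours_far[of 1, simplified]
  note nb2 = neighbours_start[of "-1", simplified] neighbours_corner[of "-1", simplified]
    neighbours_far[of "-1", simplified]
  have y1: "y 1 = v3 3 (-3) 3 \<or> y 1 = v3 0 (-2) 2"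
    using nb1(1)[of "y 1"] adj[of 0] ends k0 by simp
  have "adjacent_vertices pentagons_P (y (k - 1)) (y k)" using adj[of "k - 1"] k0 by simp
  then have last: "y (k - 1) = v3 (-3) 3 3 \<or> y (k - 1) = v3 0 2 2"
    using nb2(1) adjacent_vertices_commute[OF pentagons_P_subset] ends by metis
  have y2: "y 2 \<in> {v3 2 (-3) 3, v3 0 0 0, v3 (-1) (-1) 1} \<and> (y 2 = v3 0 0 0 \<longrightarrow> y 1 = v3 3 (-3) 3)"
    if "1 < k"
  proof -
    have "adjacent_vertices pentagons_P (y 1) (y 2)" using adj[of 1] that by (simp add: numeral_2_eq_2)
    then show ?thesis using y1 nb1(2)[of "y 2"] nb1(3)[of "y 2"] by (auto simp: v3_eq_iff)
  qed
  consider "k = 1" | "k = 2" | "k = 3" | "k = 4" using \<open>\<not> 5 \<le> k\<close> k0 by linarith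
  then show False
  proof cases
    case 1
    then show ?thesis using y1 ends by (auto simp: v3_eq_iff)
  next
    case 2
    then show ?thesis using y1 last by (auto simp: v3_eq_iff)
  next
    case 3
    then show ?thesis using y2 last by (auto simp: v3_eq_iff)
  next
    case 4
    have "adjacent_vertices pentagons_P (y 2) (y 3)" using adj[of 2] 4 by (simp add: numeral_3_eq_3)
    then have "adjacent_vertices pentagons_P (y 3) (y 2)" by (rule adjacent_vertices_commute[OF pentagons_P_subset])
    then have "y 3 = v3 (-3) 3 3 \<and> (y 2 = v3 (-2) 3 3 \<or> y 2 = v3 0 0 0) \<or>
        (y 2 = v3 (-2) 3 3 \<or> y 2 = v3 1 1 1)"
      using last 4 nb2(2)[of "y 2"] nb2(3)[of "y 2"] by auto
    then have "y 3 = v3 (-3) 3 3" "y 1 = v3 3 (-3) 3" using y2 4 by (auto simp: v3_eq_iff)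
    then have "y (Suc 0) - y 0 = v3 1 0 0" "y (Suc 3) - y 3 = v3 1 0 0"
      using ends 4 by (simp_all add: v3_arith)
    moreover have "g i = v3 1 0 0" if "i < k" "y (Suc i) - y i = v3 1 0 0" for i
    proof (rule circuit_along_first_axis)
      show "circuit pentagons_A pentagons_B (g i)" "0 < \<alpha> i" using walk that unfolding circuit_walk_def by auto
      show "v3 1 0 0 = \<alpha> i \<cdot>\<^sub>v rvec (g i)"
        using walk that unfolding circuit_walk_def by metis
    qed
    ultimately have "g 0 = v3 1 0 0" "g 3 = v3 1 0 0" using 4 by simp_all
    moreover have "g 0 \<noteq> g 3" using rep 4 by simp
    ultimately show ?thesis by simp
  qed
qed

subsection \<open>The hierarchy\<close>

lemma CD_f_symmetric_ge: "enat 3 \<le> CD {Feasible} coupled_A coupled_B no_rhs (coupled_d 1 1) (pt 0 0) (pt 0 2)"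
proof (rule le_CD, rule ccontr)
  fix k y g \<alpha>
  assume walk: "circuit_walk coupled_A coupled_B (pt 0 0) (pt 0 2) k y g \<alpha>"
    and props: "\<And>p. p \<in> {Feasible} \<Longrightarrow> has_property p coupled_A coupled_B no_rhs (coupled_d 1 1) (pt 0 0) (pt 0 2) k y g \<alpha>"
    and "\<not> 3 \<le> k"
  then show False using symmetric_short_walk[OF walk props] by simp
qed

lemma CD_fr_symmetric_ge: "enat 4 \<le> CD {Feasible, NonRepetitive} coupled_A coupled_B no_rhs (coupled_d 1 1) (pt 0 0) (pt 0 2)"
proof (rule le_CD, rule ccontr)
  fix k y g \<alpha>
  assume walk: "circuit_walk coupled_A coupled_B (pt 0 0) (pt 0 2) k y g \<alpha>"
    and props: "\<And>p. p \<in> {Feasible, NonRepetitive} \<Longrightarrow>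
      has_property p coupled_A coupled_B no_rhs (coupled_d 1 1) (pt 0 0) (pt 0 2) k y g \<alpha>"
    and "\<not> 4 \<le> k"
  then have "k = 3 \<and> g 0 = g 2" using symmetric_short_walk[OF walk props] by simp
  then show False using props[of NonRepetitive] by auto
qed

lemma CD_fm_skew_ge: "enat 3 \<le> CD {Feasible, Maximal} coupled_A coupled_B no_rhs (coupled_d 1 2) (pt 0 0) (pt (-1) 2)"
proof (rule le_CD, rule ccontr)
  fix k y g \<alpha>
  assume walk: "circuit_walk coupled_A coupled_B (pt 0 0) (pt (-1) 2) k y g \<alpha>"
    and props: "\<And>p. p \<in> {Feasible, Maximal} \<Longrightarrow>
      has_property p coupled_A coupled_B no_rhs (coupled_d 1 2) (pt 0 0) (pt (-1) 2) k y g \<alpha>"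
    and "\<not> 3 \<le> k"
  then show False using skew_short_walk[OF walk props props] by simp
qed

lemma CD_fmb_skew_ge:
  "enat 4 \<le> CD {Feasible, Maximal, NonBackwards} coupled_A coupled_B no_rhs (coupled_d 1 2) (pt 0 0) (pt (-1) 2)"
proof (rule le_CD, rule ccontr)
  fix k y g \<alpha>
  assume walk: "circuit_walk coupled_A coupled_B (pt 0 0) (pt (-1) 2) k y g \<alpha>"
    and props: "\<And>p. p \<in> {Feasible, Maximal, NonBackwards} \<Longrightarrow>
      has_property p coupled_A coupled_B no_rhs (coupled_d 1 2) (pt 0 0) (pt (-1) 2) k y g \<alpha>"
    and "\<not> 4 \<le> k"
  then have "k = 3 \<and> (g 1 = - g 0 \<or> g 2 = - g 0)" using skew_short_walk[OF walk props props] by simp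
  then show False using props[of NonBackwards] by auto
qed

lemma CD_fs_skew_ge: "enat 4 \<le> CD {Feasible, SignCompatible} coupled_A coupled_B no_rhs (coupled_d 1 2) (pt 0 0) (pt (-1) 2)"
  by (rule le_CD) (rule skew_sign_compatible_walk_ge, assumption, blast)

lemma CD_e_diagonal_ge: "enat 2 \<le> CD {Edge} coupled_A coupled_B no_rhs (coupled_d 1 1) (pt 1 0) (pt (-1) 2)"
  by (rule le_CD) (rule diagonal_edge_walk_ge, assumption, blast)

lemma CD_er_pentagons_ge:
  "enat 5 \<le> CD {Edge, NonRepetitive} pentagons_A pentagons_B no_rhs pentagons_d (v3 2 (-3) 3) (v3 (-2) 3 3)"
  by (rule le_CD) (rule pentagons_edge_walk, assumption, blast, blast)

text \<open>The intermediate sets \<open>Y'\<close> and \<open>X'\<close> let one upper and one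
  lower bound, each proved for a convenient set of properties, serve several inequalities.\<close>

lemma cd_gt_witnessI:
  assumes "Y \<subseteq> X" and "polyhedron_data n A B b d"
    and "vertex_of v1 (polyhedron_of A B b d)" "vertex_of v2 (polyhedron_of A B b d)"
    and "CD Y' A B b d v1 v2 \<le> enat k" "Y \<subseteq> Y'"
    and "enat l \<le> CD X' A B b d v1 v2" "X' \<subseteq> X" and "k < l"
  shows "CD X >\<^sub>C\<^sub>D CD Y"
proof (rule cd_gtI[OF cd_ge_superset[OF assms(1)] assms(2-4)])
  show "CD Y A B b d v1 v2 \<le> enat k" using CD_mono[OF assms(6)] assms(5) by (rule order_trans)
  show "enat l \<le> CD X A B b d v1 v2" using assms(7) CD_mono[OF assms(8)] by (rule order_trans)
qed fact

theorem theorem1: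
  shows "
   (CD {Edge, Feasible, Maximal, NonBackwards} >\<^sub>C\<^sub>D CD {Edge, Feasible, Maximal} \<and>
    CD {Edge, Feasible, Maximal, NonRepetitive} >\<^sub>C\<^sub>D CD {Edge, Feasible, Maximal}) \<and>
   (CD {Edge, Feasible, Maximal, NonBackwards} >\<^sub>C\<^sub>D CD {Feasible, Maximal, NonBackwards} \<and>
    CD {Edge, Feasible, Maximal} >\<^sub>C\<^sub>D CD {Feasible, Maximal} \<and>
    CD {Edge, Feasible, Maximal, NonRepetitive} >\<^sub>C\<^sub>D CD {Feasible, Maximal, NonRepetitive}) \<and>
   (CD {Feasible, Maximal, NonBackwards} >\<^sub>C\<^sub>D CD {Feasible, Maximal} \<and>
    CD {Feasible, Maximal, NonRepetitive} >\<^sub>C\<^sub>D CD {Feasible, Maximal}) \<and>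
   (CD {Feasible, Maximal, NonBackwards} >\<^sub>C\<^sub>D CD {Feasible, NonBackwards} \<and>
    CD {Feasible, Maximal} >\<^sub>C\<^sub>D CD {Feasible} \<and>
    CD {Feasible, Maximal, NonRepetitive} >\<^sub>C\<^sub>D CD {Feasible, NonRepetitive}) \<and>
   (CD {Feasible, NonBackwards} \<ge>\<^sub>C\<^sub>D CD {Feasible} \<and>
    CD {Feasible, NonRepetitive} >\<^sub>C\<^sub>D CD {Feasible}) \<and>
   (CD {Feasible, NonBackwards, NonRepetitive} >\<^sub>C\<^sub>D CD {Feasible, NonBackwards} \<and>
    CD {Feasible, NonBackwards, NonRepetitive} \<ge>\<^sub>C\<^sub>D CD {Feasible, NonRepetitive}) \<and>
   (CD {Feasible, SignCompatible} >\<^sub>C\<^sub>D CD {Feasible, NonBackwards, NonRepetitive}) \<and>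
   (CD {Feasible} >\<^sub>C\<^sub>D CD {})"
proof -
  have v: "vertex_of (pt 0 0) (coupled_P 1 1)" "vertex_of (pt 0 2) (coupled_P 1 1)" "vertex_of (pt 1 0) (coupled_P 1 1)"
    "vertex_of (pt (-1) 2) (coupled_P 1 1)" "vertex_of (pt 0 0) (coupled_P 1 2)" "vertex_of (pt (-1) 2) (coupled_P 1 2)"
    by (rule vertex_coupled_P; simp)+
  note symmetric = cd_gt_witnessI[OF _ polyhedron_data_coupled v(1,2)]
  note diagonal = cd_gt_witnessI[OF _ polyhedron_data_coupled v(3,4) CD_fmbr_diagonal_le _ CD_e_diagonal_ge]
  note skew = cd_gt_witnessI[OF _ polyhedron_data_coupled v(5,6)]
  note pentagons = cd_gt_witnessI[OF _ polyhedron_data_pentagons vertices_pentagons_P(1,5) CD_efm_pentagons_le _ CD_er_pentagons_ge]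
  show ?thesis
  proof (intro conjI)
    show "CD {Edge, Feasible, Maximal, NonBackwards} >\<^sub>C\<^sub>D CD {Edge, Feasible, Maximal}"
      by (rule skew[OF _ CD_efm_skew_le _ CD_fmb_skew_ge]) auto
    show "CD {Edge, Feasible, Maximal, NonRepetitive} >\<^sub>C\<^sub>D CD {Edge, Feasible, Maximal}"
      by (rule pentagons) auto
    show "CD {Edge, Feasible, Maximal, NonBackwards} >\<^sub>C\<^sub>D CD {Feasible, Maximal, NonBackwards}"
      "CD {Edge, Feasible, Maximal} >\<^sub>C\<^sub>D CD {Feasible, Maximal}"
      "CD {Edge, Feasible, Maximal, NonRepetitive} >\<^sub>C\<^sub>D CD {Feasible, Maximal, NonRepetitive}"
      by (rule diagonal; auto)+
    show "CD {Feasible, Maximal, NonBackwards} >\<^sub>C\<^sub>D CD {Feasible, Maximal}"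
      by (rule skew[OF _ CD_efm_skew_le _ CD_fmb_skew_ge]) auto
    show "CD {Feasible, Maximal, NonRepetitive} >\<^sub>C\<^sub>D CD {Feasible, Maximal}"
      by (rule symmetric[OF _ CD_fmb_symmetric_le _ CD_fr_symmetric_ge]) auto
    show "CD {Feasible, Maximal, NonBackwards} >\<^sub>C\<^sub>D CD {Feasible, NonBackwards}"
      "CD {Feasible, Maximal} >\<^sub>C\<^sub>D CD {Feasible}"
      "CD {Feasible, Maximal, NonRepetitive} >\<^sub>C\<^sub>D CD {Feasible, NonRepetitive}"
      by (rule skew[OF _ CD_fbr_skew_le _ CD_fm_skew_ge]; auto)+
    show "CD {Feasible, NonBackwards} \<ge>\<^sub>C\<^sub>D CD {Feasible}"
      "CD {Feasible, NonBackwards, NonRepetitive} \<ge>\<^sub>C\<^sub>D CD {Feasible, NonRepetitive}"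
      by (rule cd_ge_superset; auto)+
    show "CD {Feasible, NonRepetitive} >\<^sub>C\<^sub>D CD {Feasible}"
      "CD {Feasible, NonBackwards, NonRepetitive} >\<^sub>C\<^sub>D CD {Feasible, NonBackwards}"
      by (rule symmetric[OF _ CD_fmb_symmetric_le _ CD_fr_symmetric_ge]; auto)+
    show "CD {Feasible, SignCompatible} >\<^sub>C\<^sub>D CD {Feasible, NonBackwards, NonRepetitive}"
      \<comment> \<open>The two property sets are not nested, so the weak inequality comes from
        merging repeated circuits instead of monotonicity.\<close>
      by (rule cd_gtI[OF CD_fs_ge_CD_fbr polyhedron_data_coupled v(5,6) CD_fbr_skew_le CD_fs_skew_ge]) simp
    show "CD {Feasible} >\<^sub>C\<^sub>D CD {}"
      by (rule symmetric[OF _ CD_symmetric_le _ CD_f_symmetric_ge]) auto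
  qed
qed

end
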